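(* Suppose that for every $t\in\mathbb N$ the control set is $$U_t=\Big(\bigcap_{1\le k\le m_i}\{u\in\mathbb R^d:g_t^k(u)\ge0\}\Big)\cap\Big(\bigcap_{1\le j\le m_e}\{u\in\mathbb R^d:e_t^j(u)=0\}\Big),$$ where $g_t^k:\mathbb R^d\to\mathbb R$ and $e_t^j:\mathbb R^d\to\mathbb R$. Let $l\in\{1,2,3\}$ and let $(\underline{\hat x},\underline{\hat u})=((\hat x_t)_{t\in\mathbb N},(\hat u_t)_{t\in\mathbb N})$ be a solution of problem $(P^l_e)$ (defined in the context). Assume that (i)–(vii) below hold for all $t\in\mathbb N$, and that (viii) holds. (i) $\phi_t$ is Fréchet differentiable at $(\hat x_t,\hat u_t)$. (ii) $f_t$ is continuous on a neighborhood of $(\hat x_t,\hat u_t)$ and Fréchet differentiable at $(\hat x_t,\hat u_t)$. (iii) For all $k\in\{1,\dots,m_i\}$, $g_t^k$ is Fréchet differentiable at $\hat u_t$ when $g_t^k(\hat u_t)=0$. (iv) For all $k\in\{1,\dots,m_i\}$, $g_t^k$ is lower semicontinuous and Gâteaux differentiable at $\hat u_t$ when $g_t^k(\hat u_t)>0$. (v) For all $j\in\{1,\dots,m_e\}$, $e_t^j$ is continuous on a neighborhood of $\hat u_t$ and Fréchet differentiable at $\hat u_t$. (vi) $\mathrm{span}\{De_t^j(\hat u_t):j\in\{1,\dots,m_e\}\}\cap\mathrm{co}\{D_Gg_t^k(\hat u_t):k\in I_t^s\}=\emptyset$, where $I_t^s:=\{k\in\{1,\dots,m_i\}:g_t^k(\hat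 u_t)=0\}$. (vii) $De_t^1(\hat u_t),\dots,De_t^{m_e}(\hat u_t)$ are linearly independent. (viii) For all $t\in\mathbb N_*$, $D_{G,1}f_t(\hat x_t,\hat u_t)$ is invertible. Then there exist $\lambda_0\in\mathbb R$, $(p_t)_{t\in\mathbb N_*}\in(\mathbb R^{n*})^{\mathbb N_*}$, $(\lambda_{t,j})_{t\in\mathbb N}\in\mathbb R^{\mathbb N}$ for $j\in\{1,\dots,m_e\}$, and $(\mu_{t,k})_{t\in\mathbb N}\in\mathbb R^{\mathbb N}$ for $k\in\{1,\dots,m_i\}$ such that: (NN) $(\lambda_0,p_1)\ne(0,0)$. (Si) $\lambda_0\ge0$ and $\mu_{t,k}\ge0$ for all $t\in\mathbb N$ and all $k\in\{1,\dots,m_i\}$. (S$\ell$) For all $t\in\mathbb N$ and all $k\in\{1,\dots,m_i\}$, $\mu_{t,k}\cdot g_t^k(\hat u_t)=0$. (AE) For all $t\in\mathbb N_*$, $p_t=p_{t+1}\circ D_{G,1}f_t(\hat x_t,\hat u_t)+\lambda_0D_1\phi_t(\hat x_t,\hat u_t)$. (WM) For all $t\in\mathbb N$, $p_{t+1}\circ D_{G,2}f_t(\hat x_t,\hat u_t)+\lambda_0D_2\phi_t(\hat x_t,\hat u_t)+\sum_{j=1}^{m_e}\lambda_{t,j}De_t^j(\hat u_t)+\sum_{k=1}^{m_i}\mu_{t,k}D_Gg_t^k(\hat u_t)=0$.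
   Context: $\mathbb N=\{0,1,2,\dots\}$, $\mathbb N_*=\mathbb N\setminus\{0\}$; $\mathrm{co}$ denotes convex hull and $\mathrm{span}$ linear span. For each $t\in\mathbb N$, $X_t$ is a nonempty open subset of $\mathbb R^n$, $U_t$ is a nonempty subset of $\mathbb R^d$, $f_t:X_t\times U_t\to X_{t+1}$ is a mapping, and $\phi_t:X_t\times U_t\to\mathbb R$ is a function. A point $\sigma\in X_0$ is fixed. $\mathbb R^{n*}$ is the dual of $\mathbb R^n$. $\mathrm{Adm}_e$ is the set of $(\underline x,\underline u)=((x_t)_{t\in\mathbb N},(u_t)_{t\in\mathbb N})\in\prod_{t\in\mathbb N}X_t\times\prod_{t\in\mathbb N}U_t$ such that $x_0=\sigma$ and $x_{t+1}=f_t(x_t,u_t)$ for all $t\in\mathbb N$. $\mathrm{Dom}_e$ is the set of $(\underline x,\underline u)\in\mathrm{Adm}_e$ such that the series $\sum_{t=0}^{+\infty}\phi_t(x_t,u_t)$ converges in $\mathbb R$, and $J(\underline x,\underline u):=\sum_{t=0}^{+\infty}\phi_t(x_t,u_t)$ on $\mathrm{Dom}_e$. The problems are: $(P^1_e)$: maximize $J(\underline x,\underline u)$ over $(\underline x,\underline u)\in\mathrm{Dom}_e$. $(P^2_e)$: find $(\underline{\hat x},\underline{\hat u})\in\mathrm{Adm}_e$ such that for all $(\underline x,\underline u)\in\mathrm{Adm}_e$, $\limsup_{h\to+\infty}\left(\sum_{t=0}^h\phi_t(\hat x_t,\hat u_t)-\sum_{t=0}^h\phi_t(x_t,u_t)\right)\ge0$.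 $(P^3_e)$: the same with $\liminf$ in place of $\limsup$. Gâteaux differentiability: for finite-dimensional real normed spaces $E,F$, $A\subset E$, $\Phi:A\to F$ and $a\in A$, $\Phi$ is Gâteaux differentiable at $a$ when for all $v\in E$ the limit $\vec D\Phi(a,v):=\lim_{s\to0}\frac1s(\Phi(a+sv)-\Phi(a))$ exists and $v\mapsto\vec D\Phi(a,v)$ is linear; then $D_G\Phi(a)v:=\vec D\Phi(a,v)$. $D\Phi(a)$ denotes the Fréchet differential. If $E=E_1\times E_2$ and $a=(a_1,a_2)$, $D_{G,1}\Phi(a)$ (resp. $D_{G,2}\Phi(a)$) is the Gâteaux differential of $\Phi(\cdot,a_2)$ at $a_1$ (resp. of $\Phi(a_1,\cdot)$ at $a_2$), and $D_1\Phi(a),D_2\Phi(a)$ are the corresponding partial Fréchet differentials. *)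

theory Defs
  imports "HOL-Analysis.Analysis"
begin

section \<open>Differentiability\<close>

text \<open>
  Differentials are bundled as elements of \<^typ>\<open>'a \<Rightarrow>\<^sub>L 'b\<close>, so that covectors are elements of
  the real vector space \<^typ>\<open>'a \<Rightarrow>\<^sub>L real\<close> and span, convex hull and linear independence are
  available for them. As \<^const>\<open>Blinfun\<close> is meaningful for bounded linear maps only,
  \<open>frechet_D\<close> and \<open>gateaux_D\<close> are to be used at points of differentiability; linear maps
  on finite-dimensional spaces, such as Gateaux differentials, are bounded (see the lemmas below).
\<close>

definition frechet_D :: "('a::real_normed_vector \<Rightarrow> 'b::real_normed_vector) \<Rightarrow> 'a \<Rightarrow> 'a \<Rightarrow>\<^sub>L 'b" where
  "frechet_D \<Phi> a = Blinfun (frechet_derivative \<Phi> (at a))"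

definition gateaux_quotient ::
    "('a::real_normed_vector \<Rightarrow> 'b::real_normed_vector) \<Rightarrow> 'a \<Rightarrow> 'a \<Rightarrow> real \<Rightarrow> 'b" where
  "gateaux_quotient \<Phi> a v s = (1 / s) *\<^sub>R (\<Phi> (a + s *\<^sub>R v) - \<Phi> a)"

definition dir_deriv :: "('a::real_normed_vector \<Rightarrow> 'b::real_normed_vector) \<Rightarrow> 'a \<Rightarrow> 'a \<Rightarrow> 'b" where
  "dir_deriv \<Phi> a v = Lim (at 0) (gateaux_quotient \<Phi> a v)"

definition gateaux_differentiable ::
    "('a::real_normed_vector \<Rightarrow> 'b::real_normed_vector) \<Rightarrow> 'a \<Rightarrow> bool" where
  "gateaux_differentiable \<Phi> a \<longleftrightarrow>
     (\<forall>v. \<exists>l. (gateaux_quotient \<Phi> a v \<longlongrightarrow> l) (at 0)) \<and> linear (dir_deriv \<Phi> a)"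

definition gateaux_D :: "('a::real_normed_vector \<Rightarrow> 'b::real_normed_vector) \<Rightarrow> 'a \<Rightarrow> 'a \<Rightarrow>\<^sub>L 'b" where
  "gateaux_D \<Phi> a = Blinfun (dir_deriv \<Phi> a)"

abbreviation "frechet_D1 \<Phi> a1 a2 \<equiv> frechet_D (\<lambda>x. \<Phi> (x, a2)) a1"
abbreviation "frechet_D2 \<Phi> a1 a2 \<equiv> frechet_D (\<lambda>u. \<Phi> (a1, u)) a2"
abbreviation "gateaux_D1 \<Phi> a1 a2 \<equiv> gateaux_D (\<lambda>x. \<Phi> (x, a2)) a1"
abbreviation "gateaux_D2 \<Phi> a1 a2 \<equiv> gateaux_D (\<lambda>u. \<Phi> (a1, u)) a2"

definition invertible_blinfun :: "('a::real_normed_vector \<Rightarrow>\<^sub>L 'b::real_normed_vector) \<Rightarrow> bool" where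
  "invertible_blinfun A \<longleftrightarrow> (\<exists>B. B o\<^sub>L A = id_blinfun \<and> A o\<^sub>L B = id_blinfun)"

definition continuous_near :: "('a::topological_space \<Rightarrow> 'b::topological_space) \<Rightarrow> 'a \<Rightarrow> bool" where
  "continuous_near \<Phi> a \<longleftrightarrow> (\<exists>W. open W \<and> a \<in> W \<and> continuous_on W \<Phi>)"

definition lsc_at :: "('a::topological_space \<Rightarrow> real) \<Rightarrow> 'a \<Rightarrow> bool" where
  "lsc_at g a \<longleftrightarrow> (\<forall>c < g a. \<forall>\<^sub>F x in nhds a. c < g x)"

lemma has_derivative_frechet_D:
  assumes "\<Phi> differentiable (at a)"
  shows "(\<Phi> has_derivative blinfun_apply (frechet_D \<Phi> a)) (at a)"
proof -
  have "(\<Phi> has_derivative frechet_derivative \<Phi> (at a)) (at a)"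
    using assms by (simp add: frechet_derivative_works)
  then show ?thesis
    unfolding frechet_D_def by (simp add: bounded_linear_Blinfun_apply has_derivative_bounded_linear)
qed

lemma gateaux_D_apply:
  fixes \<Phi> :: "'a::euclidean_space \<Rightarrow> 'b::real_normed_vector"
  assumes "gateaux_differentiable \<Phi> a"
  shows "blinfun_apply (gateaux_D \<Phi> a) v = dir_deriv \<Phi> a v"
    and "(gateaux_quotient \<Phi> a v \<longlongrightarrow> blinfun_apply (gateaux_D \<Phi> a) v) (at 0)"
proof -
  have "bounded_linear (dir_deriv \<Phi> a)"
    using assms by (simp add: gateaux_differentiable_def linear_conv_bounded_linear)
  then show *: "blinfun_apply (gateaux_D \<Phi> a) v = dir_deriv \<Phi> a v"
    unfolding gateaux_D_def by (simp add: bounded_linear_Blinfun_apply)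
  obtain l where "(gateaux_quotient \<Phi> a v \<longlongrightarrow> l) (at 0)"
    using assms by (auto simp: gateaux_differentiable_def)
  moreover from this have "dir_deriv \<Phi> a v = l"
    unfolding dir_deriv_def by (intro tendsto_Lim) auto
  ultimately show "(gateaux_quotient \<Phi> a v \<longlongrightarrow> blinfun_apply (gateaux_D \<Phi> a) v) (at 0)"
    using * by simp
qed

lemma frechet_imp_gateaux:
  assumes "\<Phi> differentiable (at a)"
  shows "gateaux_differentiable \<Phi> a" and "gateaux_D \<Phi> a = frechet_D \<Phi> a"
proof -
  let ?L = "blinfun_apply (frechet_D \<Phi> a)"
  have lim: "(gateaux_quotient \<Phi> a v \<longlongrightarrow> ?L v) (at 0)" for v
  proof -
    have "((\<lambda>s::real. a + s *\<^sub>R v) has_derivative (\<lambda>s. s *\<^sub>R v)) (at 0)"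
      by (auto intro!: derivative_eq_intros)
    moreover have "(\<Phi> has_derivative ?L) (at (a + (0::real) *\<^sub>R v))"
      using has_derivative_frechet_D[OF assms] by simp
    ultimately have "((\<lambda>s. \<Phi> (a + s *\<^sub>R v)) has_derivative (\<lambda>s. ?L (s *\<^sub>R v))) (at 0)"
      by (rule has_derivative_compose)
    then have "((\<lambda>s. norm (\<Phi> (a + s *\<^sub>R v) - \<Phi> a - s *\<^sub>R ?L v) / norm s) \<longlongrightarrow> 0) (at 0)"
      by (simp add: has_derivative_at blinfun.scaleR_right)
    moreover have "norm (\<Phi> (a + s *\<^sub>R v) - \<Phi> a - s *\<^sub>R ?L v) / norm s
        = norm (gateaux_quotient \<Phi> a v s - ?L v)" if "s \<noteq> 0" for s
    proof -
      have "gateaux_quotient \<Phi> a v s - ?L v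
          = (1 / s) *\<^sub>R (\<Phi> (a + s *\<^sub>R v) - \<Phi> a - s *\<^sub>R ?L v)"
        using that by (simp add: gateaux_quotient_def scaleR_diff_right)
      then show ?thesis by simp
    qed
    ultimately have "((\<lambda>s. norm (gateaux_quotient \<Phi> a v s - ?L v)) \<longlongrightarrow> 0) (at 0)"
      by (subst (asm) Lim_cong_within[OF refl refl refl]) auto
    then show ?thesis
      by (simp add: tendsto_norm_zero_iff LIM_zero_iff)
  qed
  then have eq: "dir_deriv \<Phi> a = ?L"
    unfolding dir_deriv_def by (intro ext tendsto_Lim) auto
  show "gateaux_differentiable \<Phi> a"
    unfolding gateaux_differentiable_def eq
    using lim by (auto intro: blinfun.bounded_linear_right bounded_linear.linear)
  show "gateaux_D \<Phi> a = frechet_D \<Phi> a"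
    by (simp add: gateaux_D_def eq blinfun_apply_inverse)
qed


section \<open>The infinite-horizon problems\<close>

text \<open>
  The maps \<open>f t\<close> and \<open>\<phi> t\<close> are total functions on the ambient product space. In the problems
  below only their values on \<open>X t \<times> U t\<close> matter; for differentials with respect to the control
  they are also used off \<open>U t\<close>, which may have empty interior.
\<close>

definition admissible ::
    "(nat \<Rightarrow> 'x set) \<Rightarrow> (nat \<Rightarrow> 'u set) \<Rightarrow> (nat \<Rightarrow> 'x \<times> 'u \<Rightarrow> 'x) \<Rightarrow> 'x
      \<Rightarrow> ((nat \<Rightarrow> 'x) \<times> (nat \<Rightarrow> 'u)) set" where
  "admissible X U f \<sigma> = {(x, u). (\<forall>t. x t \<in> X t) \<and> (\<forall>t. u t \<in> U t) \<and>
     x 0 = \<sigma> \<and> (\<forall>t. x (Suc t) = f t (x t, u t))}"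

definition dom_e ::
    "(nat \<Rightarrow> 'x set) \<Rightarrow> (nat \<Rightarrow> 'u set) \<Rightarrow> (nat \<Rightarrow> 'x \<times> 'u \<Rightarrow> 'x) \<Rightarrow> 'x
      \<Rightarrow> (nat \<Rightarrow> 'x \<times> 'u \<Rightarrow> real) \<Rightarrow> ((nat \<Rightarrow> 'x) \<times> (nat \<Rightarrow> 'u)) set" where
  "dom_e X U f \<sigma> \<phi> = {(x, u) \<in> admissible X U f \<sigma>. summable (\<lambda>t. \<phi> t (x t, u t))}"

definition J :: "(nat \<Rightarrow> 'x \<times> 'u \<Rightarrow> real) \<Rightarrow> (nat \<Rightarrow> 'x) \<times> (nat \<Rightarrow> 'u) \<Rightarrow> real" where
  "J \<phi> = (\<lambda>(x, u). \<Sum>t. \<phi> t (x t, u t))"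

definition J_upto ::
    "(nat \<Rightarrow> 'x \<times> 'u \<Rightarrow> real) \<Rightarrow> (nat \<Rightarrow> 'x) \<times> (nat \<Rightarrow> 'u) \<Rightarrow> nat \<Rightarrow> real" where
  "J_upto \<phi> = (\<lambda>(x, u) h. \<Sum>t=0..h. \<phi> t (x t, u t))"

definition solution_P1 where
  "solution_P1 X U f \<sigma> \<phi> z \<longleftrightarrow>
     z \<in> dom_e X U f \<sigma> \<phi> \<and> (\<forall>w \<in> dom_e X U f \<sigma> \<phi>. J \<phi> w \<le> J \<phi> z)"

definition solution_P2 where
  "solution_P2 X U f \<sigma> \<phi> z \<longleftrightarrow> z \<in> admissible X U f \<sigma> \<and>
     (\<forall>w \<in> admissible X U f \<sigma>. limsup (\<lambda>h. ereal (J_upto \<phi> z h - J_upto \<phi> w h)) \<ge> 0)"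

definition solution_P3 where
  "solution_P3 X U f \<sigma> \<phi> z \<longleftrightarrow> z \<in> admissible X U f \<sigma> \<and>
     (\<forall>w \<in> admissible X U f \<sigma>. liminf (\<lambda>h. ereal (J_upto \<phi> z h - J_upto \<phi> w h)) \<ge> 0)"

end

theory Submission
  imports Defs
begin

text \<open>
  A solution is optimal, for every horizon \<open>h\<close>, among the admissible processes that agree with it
  after \<open>h\<close>. Linearizing at the solution and taking controls in the open cones
  \<open>{v. De v = 0, Dg v > 0 (active g)}\<close>, which are nonempty by (vi), gives a convex cone of pairs
  (payoff variation, terminal state variation) in \<open>\<real> \<times> \<real>\<^sup>n\<close>. If \<open>(1, 0)\<close> were interior to it, Brouwer's theorem
  would correct the linearized improvement to a better admissible process with the same terminal state; only
  differentiability at a point and continuity nearby are used. Hence a hyperplane separates, and its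
  normal is \<open>(\<lambda>\<^sub>0, p\<^sub>h\<^sub>+\<^sub>1)\<close>. By (viii) all \<open>p\<^sub>t\<close> depend linearly on \<open>(\<lambda>\<^sub>0, p\<^sub>1)\<close>, so the finite horizon conditions cut out nested
  nonempty compact subsets of the unit sphere; a common point serves every horizon. Farkas' lemma
  then produces the multipliers of the control constraints one \<open>t\<close> at a time.
\<close>

section \<open>Zeros of maps on finite-dimensional cubes\<close>

text \<open>The data are assumed differentiable only at the reference process, so the equality
  constraints cannot be solved by an implicit function theorem. A topological zero theorem asks only
  that the rescaled residual of the equations be close to the identity on a cube of coefficients.
  Hence directional limits are proved uniformly over a parameter set, and a dual family of
  directions, one per scalar equation, is built with the help of (vii). Strict positivity on the
  active inequalities leaves room for these corrections, so inequalities never enter the system to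
  be solved. Fixing the terminal state lets a competitor rejoin the reference process, after which
  the three optimality notions say the same. In the passage to all horizons the unknown is
  \<open>(l0, p)\<close> alone: the control constraints are kept as a sign condition on cones, so
  their multipliers need no bounds, and the normalization of \<open>(l0, p)\<close> excludes a
  trivial limit.\<close>

text \<open>
  The number of equality constraints grows with the horizon, so the dimension cannot be encoded
  in a type of class \<^class>\<open>euclidean_space\<close>, as the library's version of Brouwer's theorem requires. Kuhn's
  combinatorial lemma is therefore used for functions on index sets.
\<close>

lemma compact_nat_cube:
  "compact {x::nat \<Rightarrow> real. (\<forall>i<n. 0 \<le> x i \<and> x i \<le> 1) \<and> (\<forall>i\<ge>n. x i = 0)}"
proof -
  have "{x::nat \<Rightarrow> real. (\<forall>i<n. 0 \<le> x i \<and> x i \<le> 1) \<and> (\<forall>i\<ge>n. x i = 0)}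
      = PiE UNIV (\<lambda>i. if i < n then {0..1} else {0})"
    by (fastforce simp: PiE_iff split: if_splits)
  moreover have "compactin (product_topology (\<lambda>i. euclidean :: real topology) UNIV)
      (PiE UNIV (\<lambda>i::nat. if i < n then {0..1} else {0}))"
    by (simp add: compactin_PiE)
  ultimately show ?thesis
    by (simp add: euclidean_product_topology)
qed

lemma tendsto_componentwise_fun:
  fixes X :: "'c \<Rightarrow> 'i \<Rightarrow> 'b::topological_space"
  assumes "\<And>i. ((\<lambda>k. X k i) \<longlongrightarrow> x i) F"
  shows "(X \<longlongrightarrow> x) F"
proof -
  have "limitin (product_topology (\<lambda>i. euclidean :: 'b topology) UNIV) X x F"
    using assms by (simp add: limitin_componentwise)
  then show ?thesis
    by (simp add: euclidean_product_topology)
qed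

lemma tendsto_apply_fun:
  fixes X :: "'c \<Rightarrow> 'i \<Rightarrow> 'b::topological_space"
  assumes "(X \<longlongrightarrow> x) F"
  shows "((\<lambda>k. X k i) \<longlongrightarrow> x i) F"
proof -
  have "limitin (product_topology (\<lambda>i. euclidean :: 'b topology) UNIV) X x F"
    using assms by (simp add: euclidean_product_topology)
  then show ?thesis
    by (simp add: limitin_componentwise)
qed

text \<open>Grid points are labelled by the signs of the components of \<open>G\<close>. For each
  mesh Kuhn's lemma gives a cell on which every component takes both weak signs; by compactness the
  cells accumulate at a point, where continuity makes every component vanish.\<close>

lemma poincare_miranda_nat:
  fixes G :: "(nat \<Rightarrow> real) \<Rightarrow> nat \<Rightarrow> real" and n :: nat
  defines "C \<equiv> {x. (\<forall>i<n. 0 \<le> x i \<and> x i \<le> 1) \<and> (\<forall>i\<ge>n. x i = 0)}"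
  assumes cont: "\<And>i. i < n \<Longrightarrow> continuous_on C (\<lambda>x. G x i)"
    and low: "\<And>x i. x \<in> C \<Longrightarrow> i < n \<Longrightarrow> x i = 0 \<Longrightarrow> G x i \<le> 0"
    and high: "\<And>x i. x \<in> C \<Longrightarrow> i < n \<Longrightarrow> x i = 1 \<Longrightarrow> G x i \<ge> 0"
  shows "\<exists>x\<in>C. \<forall>i<n. G x i = 0"
proof -
  define grid where "grid p y i = (if i < n then real (y i) / real p else 0)" for p :: nat and y :: "nat \<Rightarrow> nat" and i
  \<comment> \<open>The clause \<open>x i < 1\<close> forces label 1 on the upper face even where
    \<open>G\<close> vanishes, as Kuhn's lemma demands; there the sign of \<open>G\<close> is known
    from \<open>high\<close>.\<close>
  define label where "label x i = (if x i < 1 \<and> G x i \<le> 0 then 0 else 1 :: nat)" for x i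
  have grid: "grid p y \<in> C" if "p > 0" "\<forall>i<n. y i \<le> p" for p y
    using that by (auto simp: C_def grid_def)
  have label0: "G x i \<le> 0" if "label x i = 0" for x i
    using that by (simp add: label_def split: if_splits)
  have label1: "G x i \<ge> 0" if "label x i \<noteq> 0" "x \<in> C" "i < n" for x i
    using that high[of x i] by (force simp: label_def C_def split: if_splits)
  have step: "\<exists>z a b. z \<in> C \<and> (\<forall>i<n. a i \<in> C \<and> b i \<in> C \<and> G (a i) i \<le> 0 \<and> G (b i) i \<ge> 0 \<and>
      (\<forall>j. \<bar>a i j - z j\<bar> \<le> 1 / real (Suc k) \<and> \<bar>b i j - z j\<bar> \<le> 1 / real (Suc k)))" for k
  proof -
    define p where "p = Suc k"
    have p: "p > 0" by (simp add: p_def)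
    obtain q where q: "\<forall>i<n. q i < p"
      and rs: "\<forall>i<n. \<exists>r s. (\<forall>j<n. q j \<le> r j \<and> r j \<le> q j + 1) \<and>
        (\<forall>j<n. q j \<le> s j \<and> s j \<le> q j + 1) \<and> label (grid p r) i \<noteq> label (grid p s) i"
    proof (rule kuhn_lemma[of p n "\<lambda>y. label (grid p y)"])
      show "\<forall>x. (\<forall>i<n. x i \<le> p) \<longrightarrow> (\<forall>i<n. x i = 0 \<longrightarrow> label (grid p x) i = 0)"
      proof (intro allI impI)
        fix y i assume y: "\<forall>i<n. y i \<le> p" "i < n" "y i = 0"
        then have "grid p y i = 0" by (simp add: grid_def)
        then show "label (grid p y) i = 0"
          using low[OF grid[OF p y(1)] y(2)] by (simp add: label_def)
      qed
      show "\<forall>x. (\<forall>i<n. x i \<le> p) \<longrightarrow> (\<forall>i<n. x i = p \<longrightarrow> label (grid p x) i = 1)"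
        using p by (auto simp: label_def grid_def)
    qed (use p in \<open>auto simp: label_def\<close>)
    have near: "\<bar>grid p r j - grid p q j\<bar> \<le> 1 / real p"
      if "\<forall>j<n. q j \<le> r j \<and> r j \<le> q j + 1" for r j
    proof (cases "j < n")
      case True
      then have "0 \<le> real (r j) - real (q j)" "real (r j) - real (q j) \<le> 1"
        using that by force+
      then show ?thesis
        using True p by (simp add: grid_def divide_right_mono flip: diff_divide_distrib)
    qed (simp add: grid_def)
    have "\<exists>a b. a \<in> C \<and> b \<in> C \<and> G a i \<le> 0 \<and> G b i \<ge> 0 \<and>
        (\<forall>j. \<bar>a j - grid p q j\<bar> \<le> 1 / real p \<and> \<bar>b j - grid p q j\<bar> \<le> 1 / real p)" if i: "i < n" for i
    proof -
      obtain r s where r: "\<forall>j<n. q j \<le> r j \<and> r j \<le> q j + 1"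
        and s: "\<forall>j<n. q j \<le> s j \<and> s j \<le> q j + 1"
        and ne: "label (grid p r) i \<noteq> label (grid p s) i"
        using rs i by blast
      have C: "grid p r \<in> C" "grid p s \<in> C"
        using r s q by (auto intro!: grid[OF p] simp: Suc_le_eq) (meson le_trans Suc_leI)+
      show ?thesis
      proof (cases "label (grid p r) i = 0")
        case True
        then show ?thesis
          using C near[OF r] near[OF s] label0[of "grid p r" i] label1[of "grid p s" i] ne i by metis
      next
        case False
        then have "label (grid p s) i = 0"
          using ne by (auto simp: label_def split: if_splits)
        then show ?thesis
          using C near[OF r] near[OF s] label0[of "grid p s" i] label1[of "grid p r" i] False i by metis
      qed
    qed
    then obtain a b where "\<forall>i<n. a i \<in> C \<and> b i \<in> C \<and> G (a i) i \<le> 0 \<and> G (b i) i \<ge> 0 \<and>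
        (\<forall>j. \<bar>a i j - grid p q j\<bar> \<le> 1 / real p \<and> \<bar>b i j - grid p q j\<bar> \<le> 1 / real p)"
      by metis
    moreover have "grid p q \<in> C"
      using q by (intro grid[OF p]) (auto intro: less_imp_le)
    ultimately show ?thesis
      unfolding p_def by blast
  qed
  then obtain z a b where z: "\<And>k. z k \<in> C"
    and ab: "\<And>k i. i < n \<Longrightarrow> a k i \<in> C \<and> b k i \<in> C \<and> G (a k i) i \<le> 0 \<and> G (b k i) i \<ge> 0 \<and>
      (\<forall>j. \<bar>a k i j - z k j\<bar> \<le> 1 / real (Suc k) \<and> \<bar>b k i j - z k j\<bar> \<le> 1 / real (Suc k))"
    by metis
  have "seq_compact C"
    unfolding C_def using compact_nat_cube by (simp add: compact_imp_seq_compact)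
  then obtain x \<tau> where x: "x \<in> C" and \<tau>: "strict_mono \<tau>" and lim: "(z \<circ> \<tau>) \<longlonglongrightarrow> x"
    using z unfolding seq_compact_def by blast
  have small: "(\<lambda>k. 1 / real (Suc (\<tau> k))) \<longlonglongrightarrow> 0"
    using LIMSEQ_subseq_LIMSEQ[OF lim_1_over_n[where 'a=real, THEN LIMSEQ_Suc] \<tau>] by (simp add: o_def)
  have close: "(\<lambda>k. w (\<tau> k)) \<longlonglongrightarrow> x"
    if "\<And>k j. \<bar>w k j - z k j\<bar> \<le> 1 / real (Suc k)" for w
  proof (rule tendsto_componentwise_fun)
    fix j
    have "(\<lambda>k. w (\<tau> k) j - z (\<tau> k) j) \<longlonglongrightarrow> 0"
      by (rule Lim_null_comparison[OF _ small]) (simp add: that del: of_nat_Suc)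
    moreover have "(\<lambda>k. z (\<tau> k) j) \<longlonglongrightarrow> x j"
      using tendsto_apply_fun[OF lim] by (simp add: o_def)
    ultimately show "(\<lambda>k. w (\<tau> k) j) \<longlonglongrightarrow> x j"
      using tendsto_add by fastforce
  qed
  have "G x i = 0" if i: "i < n" for i
  proof -
    have "(\<lambda>k. G (a (\<tau> k) i) i) \<longlonglongrightarrow> G x i" "(\<lambda>k. G (b (\<tau> k) i) i) \<longlonglongrightarrow> G x i"
      using ab i x
      by (auto intro!: continuous_on_tendsto_compose[OF cont[OF i]] close[of "\<lambda>k. a k i"] close[of "\<lambda>k. b k i"])
    then show ?thesis
      using ab[OF i] by (intro antisym) (auto intro: LIMSEQ_le_const LIMSEQ_le_const2)
  qed
  with x show ?thesis by blast
qed

definition unit_cube :: "'i set \<Rightarrow> ('i \<Rightarrow> real) set" where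
  "unit_cube I = {c. (\<forall>i\<in>I. \<bar>c i\<bar> \<le> 1) \<and> (\<forall>i. i \<notin> I \<longrightarrow> c i = 0)}"

text \<open>Opposite faces lie at distance 1 from the centre, so a map within 1 of the identity
  keeps the weak sign of each coordinate on them. This is the sign condition of
  \<open>poincare_miranda_nat\<close> after the rescaling \<open>T\<close>.\<close>

lemma near_identity_zero:
  fixes G :: "('i \<Rightarrow> real) \<Rightarrow> 'i \<Rightarrow> real"
  assumes "finite I"
    and cont: "\<And>i. i \<in> I \<Longrightarrow> continuous_on (unit_cube I) (\<lambda>c. G c i)"
    and near: "\<And>c i. c \<in> unit_cube I \<Longrightarrow> i \<in> I \<Longrightarrow> \<bar>G c i - c i\<bar> \<le> 1"
  shows "\<exists>c\<in>unit_cube I. \<forall>i\<in>I. G c i = 0"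
proof -
  obtain b where b: "bij_betw b {..<card I} I"
    using ex_bij_betw_nat_finite[OF \<open>finite I\<close>] by (auto simp: atLeast0LessThan)
  define b' where "b' = inv_into {..<card I} b"
  have b': "b' i < card I" "b (b' i) = i" if "i \<in> I" for i
    using that b bij_betw_inv_into_right[OF b] bij_betw_inv_into[OF b] by (auto simp: b'_def bij_betw_def)
  have bb: "b k \<in> I" "b' (b k) = k" if "k < card I" for k
    using that b bij_betw_inv_into_left[OF b] by (auto simp: b'_def bij_betw_def)
  define C where "C = {x::nat \<Rightarrow> real. (\<forall>i<card I. 0 \<le> x i \<and> x i \<le> 1) \<and> (\<forall>i\<ge>card I. x i = 0)}"
  define T where "T x i = (if i \<in> I then 2 * x (b' i) - 1 else 0 :: real)" for x i
  have T: "T x \<in> unit_cube I" if "x \<in> C" for x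
    using that b' by (force simp: C_def T_def unit_cube_def abs_le_iff)
  have contT: "continuous_on C T"
  proof (rule continuous_on_coordinatewise_then_product)
    fix i
    have "continuous_on C (\<lambda>x. x (b' i))"
      by (rule continuous_on_product_then_coordinatewise) (rule continuous_on_id)
    then show "continuous_on C (\<lambda>x. T x i)"
      by (cases "i \<in> I") (auto simp: T_def intro!: continuous_intros)
  qed
  have "\<exists>x\<in>C. \<forall>k<card I. G (T x) (b k) = 0"
  proof (rule poincare_miranda_nat[of "card I" "\<lambda>x k. G (T x) (b k)", folded C_def])
    show "continuous_on C (\<lambda>x. G (T x) (b k))" if "k < card I" for k
      using continuous_on_compose2[OF cont contT] bb that T by blast
    show "G (T x) (b k) \<le> 0" if "x \<in> C" "k < card I" "x k = 0" for x k
      using near[OF T, of x "b k"] that bb by (auto simp: T_def)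
    show "G (T x) (b k) \<ge> 0" if "x \<in> C" "k < card I" "x k = 1" for x k
      using near[OF T, of x "b k"] that bb by (auto simp: T_def)
  qed
  then show ?thesis
    using T b' by metis
qed

section \<open>Differentiability along uniformly convergent directions\<close>

text \<open>The remainder at \<open>a\<close> is small relative to the length of the displacement,
  whatever its direction. Differentiability at one point therefore controls a bounded family of
  directions at once, even when they depend on \<open>s\<close>.\<close>

lemma has_derivative_uniform_limit:
  fixes F :: "'a::real_normed_vector \<Rightarrow> 'b::real_normed_vector"
  assumes F: "(F has_derivative F') (at a)"
    and q: "uniform_limit \<Gamma> q q0 (at_right (0::real))"
    and q0: "bounded (q0 ` \<Gamma>)"
  shows "uniform_limit \<Gamma> (\<lambda>s c. (1 / s) *\<^sub>R (F (a + s *\<^sub>R q s c) - F a)) (\<lambda>c. F' (q0 c)) (at_right 0)"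
proof (rule uniform_limitI)
  fix e :: real assume e: "e > 0"
  obtain B where B: "B > 0" "\<And>c. c \<in> \<Gamma> \<Longrightarrow> norm (q0 c) \<le> B"
    using q0 by (force simp: bounded_pos)
  have bl: "bounded_linear F'" using F by (rule has_derivative_bounded_linear)
  obtain K where K: "K > 0" "\<And>x. norm (F' x) \<le> norm x * K"
    using bounded_linear.pos_bounded[OF bl] by blast
  \<comment> \<open>Half of \<open>e\<close> pays for the remainder along directions of norm at most
    \<open>B + 1\<close>, the other half for \<open>F' (q s c) - F' (q0 c)\<close>, bounded through
    \<open>K\<close>.\<close>
  define \<eta> where "\<eta> = e / (2 * (B + 1))"
  have \<eta>: "\<eta> > 0" "\<eta> * (B + 1) = e / 2" using e B by (auto simp: \<eta>_def field_simps add_pos_pos)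
  obtain d where d: "d > 0" "\<And>y. norm (y - a) < d \<Longrightarrow> norm (F y - F a - F' (y - a)) \<le> \<eta> * norm (y - a)"
    using F \<eta>(1) unfolding has_derivative_at_alt by blast
  have "\<forall>\<^sub>F s in at_right 0. \<forall>c\<in>\<Gamma>. dist (q s c) (q0 c) < min 1 (e / (2 * K))"
    using q e K by (intro uniform_limitD) auto
  moreover have "\<forall>\<^sub>F s in at_right 0. s < d / (B + 1)" "\<forall>\<^sub>F s::real in at_right 0. 0 < s"
    using d B by (auto intro: eventually_at_right_less order_tendstoD(2)[OF tendsto_ident_at])
  ultimately show "\<forall>\<^sub>F s in at_right 0. \<forall>c\<in>\<Gamma>.
      dist ((1 / s) *\<^sub>R (F (a + s *\<^sub>R q s c) - F a)) (F' (q0 c)) < e"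
  proof eventually_elim
    case (elim s)
    show ?case
    proof
      fix c assume c: "c \<in> \<Gamma>"
      have dq: "norm (q s c - q0 c) < 1" "norm (q s c - q0 c) < e / (2 * K)"
        using elim(1) c by (auto simp: dist_norm)
      then have nq: "norm (q s c) \<le> B + 1"
        using B(2)[OF c] norm_triangle_ineq[of "q s c - q0 c" "q0 c"] by simp
      then have "norm (s *\<^sub>R q s c) \<le> s * (B + 1)"
        using elim by simp
      also have "s * (B + 1) < d"
        using elim B by (simp add: field_simps)
      finally have "norm (F (a + s *\<^sub>R q s c) - F a - F' (s *\<^sub>R q s c)) \<le> \<eta> * norm (s *\<^sub>R q s c)"
        using d(2)[of "a + s *\<^sub>R q s c"] by simp
      also have "\<dots> \<le> s * (e / 2)"
        using elim nq \<eta>(1) unfolding \<eta>(2)[symmetric] by simp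
      finally have r: "norm (F (a + s *\<^sub>R q s c) - F a - F' (s *\<^sub>R q s c)) \<le> s * (e / 2)" .
      have "norm ((1 / s) *\<^sub>R (F (a + s *\<^sub>R q s c) - F a) - F' (q s c))
          = norm ((1 / s) *\<^sub>R (F (a + s *\<^sub>R q s c) - F a - F' (s *\<^sub>R q s c)))"
        using elim by (simp add: linear_cmul[OF bounded_linear.linear[OF bl]] scaleR_diff_right)
      also have "\<dots> = norm (F (a + s *\<^sub>R q s c) - F a - F' (s *\<^sub>R q s c)) / s"
        using elim by (simp only: norm_scaleR) simp
      also have "\<dots> \<le> e / 2"
        using r elim by (simp add: pos_divide_le_eq mult.commute)
      finally have 1: "norm ((1 / s) *\<^sub>R (F (a + s *\<^sub>R q s c) - F a) - F' (q s c)) \<le> e / 2" .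
      have "norm (F' (q s c) - F' (q0 c)) \<le> norm (q s c - q0 c) * K"
        using K(2)[of "q s c - q0 c"] by (simp add: linear_diff[OF bounded_linear.linear[OF bl]])
      also have "\<dots> < e / 2"
        using dq K by (simp add: field_simps)
      finally show "dist ((1 / s) *\<^sub>R (F (a + s *\<^sub>R q s c) - F a)) (F' (q0 c)) < e"
        using 1 norm_triangle_ineq[of "(1 / s) *\<^sub>R (F (a + s *\<^sub>R q s c) - F a) - F' (q s c)" "F' (q s c) - F' (q0 c)"]
        by (simp add: dist_norm)
    qed
  qed
qed

lemma uniform_limit_Pair:
  assumes "uniform_limit \<Gamma> p p0 F" "uniform_limit \<Gamma> q q0 F"
  shows "uniform_limit \<Gamma> (\<lambda>s c. (p s c, q s c)) (\<lambda>c. (p0 c, q0 c)) F"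
proof (rule uniform_limitI)
  fix e :: real assume e: "e > 0"
  then have "\<forall>\<^sub>F s in F. \<forall>c\<in>\<Gamma>. dist (p s c) (p0 c) < e / 2" "\<forall>\<^sub>F s in F. \<forall>c\<in>\<Gamma>. dist (q s c) (q0 c) < e / 2"
    using assms by (auto intro: uniform_limitD simp del: less_divide_eq_numeral1)
  then show "\<forall>\<^sub>F s in F. \<forall>c\<in>\<Gamma>. dist (p s c, q s c) (p0 c, q0 c) < e"
  proof eventually_elim
    case (elim s)
    show ?case
    proof
      fix c assume "c \<in> \<Gamma>"
      with elim show "dist (p s c, q s c) (p0 c, q0 c) < e"
        using sqrt_sum_squares_le_sum[of "dist (p s c) (p0 c)" "dist (q s c) (q0 c)"]
        by (fastforce simp: dist_Pair_Pair)
    qed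
  qed
qed

text \<open>Directions within distance 1 of a bounded family are bounded, so the displacements
  shrink uniformly: one step size serves all parameters when a property holds only near
  \<open>a\<close>.\<close>

lemma uniform_limit_eventually_open:
  fixes q :: "real \<Rightarrow> 'c \<Rightarrow> 'a::real_normed_vector"
  assumes q: "uniform_limit \<Gamma> q q0 (at_right 0)" and q0: "bounded (q0 ` \<Gamma>)"
    and W: "open W" "a \<in> W"
  shows "\<forall>\<^sub>F s in at_right 0. \<forall>c\<in>\<Gamma>. a + s *\<^sub>R q s c \<in> W"
proof -
  obtain B where B: "B > 0" "\<And>c. c \<in> \<Gamma> \<Longrightarrow> norm (q0 c) \<le> B"
    using q0 by (force simp: bounded_pos)
  obtain d where d: "d > 0" "ball a d \<subseteq> W"
    using W open_contains_ball by blast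
  have "\<forall>\<^sub>F s in at_right 0. \<forall>c\<in>\<Gamma>. dist (q s c) (q0 c) < 1"
    using q by (intro uniform_limitD) auto
  moreover have "\<forall>\<^sub>F s in at_right 0. s < d / (B + 1)" "\<forall>\<^sub>F s::real in at_right 0. 0 < s"
    using d B by (auto intro: eventually_at_right_less order_tendstoD(2)[OF tendsto_ident_at])
  ultimately show ?thesis
  proof eventually_elim
    case (elim s)
    show ?case
    proof
      fix c assume c: "c \<in> \<Gamma>"
      then have "norm (q s c) \<le> B + 1"
        using B(2)[OF c] norm_triangle_ineq[of "q s c - q0 c" "q0 c"] elim(1) by (fastforce simp: dist_norm)
      then have "norm (s *\<^sub>R q s c) \<le> s * (B + 1)"
        using elim by simp
      also have "s * (B + 1) < d"
        using elim B by (simp add: field_simps)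
      finally have "a + s *\<^sub>R q s c \<in> ball a d"
        by (simp add: dist_norm)
      then show "a + s *\<^sub>R q s c \<in> W" using d by blast
    qed
  qed
qed

lemma uniform_limit_eventually_pos:
  fixes q :: "real \<Rightarrow> 'c \<Rightarrow> real"
  assumes "uniform_limit \<Gamma> q l F" "m > 0" "\<And>c. c \<in> \<Gamma> \<Longrightarrow> l c \<ge> m"
  shows "\<forall>\<^sub>F s in F. \<forall>c\<in>\<Gamma>. q s c > 0"
  using uniform_limitD[OF assms(1,2)]
proof eventually_elim
  case (elim s)
  then show ?case using assms(3) by (fastforce simp: dist_real_def abs_less_iff)
qed

lemma uniform_limit_sum:
  fixes q :: "'i \<Rightarrow> 'b \<Rightarrow> 'c \<Rightarrow> 'd::real_normed_vector"
  assumes "\<And>i. i \<in> I \<Longrightarrow> uniform_limit \<Gamma> (q i) (l i) F"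
  shows "uniform_limit \<Gamma> (\<lambda>s c. \<Sum>i\<in>I. q i s c) (\<lambda>c. \<Sum>i\<in>I. l i c) F"
  using assms
proof (induction I rule: infinite_finite_induct)
  case (insert i I)
  then show ?case by (simp add: uniform_limit_add)
qed (simp_all add: uniform_limit_const)

section \<open>Controlled trajectories and their first variation\<close>

primrec trajectory :: "(nat \<Rightarrow> 'x \<times> 'u \<Rightarrow> 'x) \<Rightarrow> 'x \<Rightarrow> (nat \<Rightarrow> 'u) \<Rightarrow> nat \<Rightarrow> 'x" where
  "trajectory f x0 u 0 = x0"
| "trajectory f x0 u (Suc t) = f t (trajectory f x0 u t, u t)"

lemma trajectory_cong:
  "(\<And>s. s < t \<Longrightarrow> u s = v s) \<Longrightarrow> trajectory f x0 u t = trajectory f x0 v t"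
  by (induction t) auto

text \<open>\<open>trajectory A 0\<close> solves the linearized state equation, started at 0 because
  the initial state is fixed. The induction applies the derivative of \<open>f t\<close> along the
  state quotient paired with the control direction; the former depends on \<open>s\<close>, which is
  why limits of directions are needed.\<close>

lemma trajectory_uniform_limit:
  fixes f :: "nat \<Rightarrow> 'x::real_normed_vector \<times> 'u::real_normed_vector \<Rightarrow> 'x"
  assumes A: "\<And>t. (f t has_derivative A t) (at (xh t, uh t))"
    and xh: "\<And>t. xh (Suc t) = f t (xh t, uh t)"
    and \<omega>: "\<And>t. bounded ((\<lambda>c. \<omega> c t) ` \<Gamma>)"
  defines "x \<equiv> \<lambda>s c. trajectory f (xh 0) (\<lambda>t. uh t + s *\<^sub>R \<omega> c t)"
    and "y \<equiv> \<lambda>c. trajectory A 0 (\<omega> c)"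
  shows "bounded ((\<lambda>c. y c t) ` \<Gamma>) \<and>
    uniform_limit \<Gamma> (\<lambda>s c. (1 / s) *\<^sub>R (x s c t - xh t)) (\<lambda>c. y c t) (at_right 0)"
proof (induction t)
  case 0
  show ?case
    by (auto simp: x_def y_def image_constant_conv uniform_limit_const)
next
  case (Suc t)
  let ?q = "\<lambda>s c. ((1 / s) *\<^sub>R (x s c t - xh t), \<omega> c t)" and ?lq = "\<lambda>c. (y c t, \<omega> c t)"
  have "bounded (((\<lambda>c. y c t) ` \<Gamma>) \<times> ((\<lambda>c. \<omega> c t) ` \<Gamma>))"
    using Suc \<omega> by (intro bounded_Times) auto
  then have bq: "bounded (?lq ` \<Gamma>)"
    by (rule bounded_subset) auto
  have "uniform_limit \<Gamma> ?q ?lq (at_right 0)"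
    using Suc by (intro uniform_limit_Pair uniform_limit_const) auto
  note lim = has_derivative_uniform_limit[OF A this bq]
  have "\<forall>\<^sub>F s in at_right 0. \<forall>c\<in>\<Gamma>.
      (1 / s) *\<^sub>R (f t ((xh t, uh t) + s *\<^sub>R ?q s c) - f t (xh t, uh t)) = (1 / s) *\<^sub>R (x s c (Suc t) - xh (Suc t))"
    using eventually_at_right_less[of 0] by eventually_elim (simp add: x_def xh)
  from uniform_limit_cong[OF this, THEN iffD1, OF _ lim]
  have "uniform_limit \<Gamma> (\<lambda>s c. (1 / s) *\<^sub>R (x s c (Suc t) - xh (Suc t))) (\<lambda>c. y c (Suc t)) (at_right 0)"
    by (simp add: y_def)
  moreover have "(\<lambda>c. y c (Suc t)) ` \<Gamma> = A t ` ?lq ` \<Gamma>"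
    by (simp add: image_image y_def)
  then have "bounded ((\<lambda>c. y c (Suc t)) ` \<Gamma>)"
    using bounded_linear_image[OF bq has_derivative_bounded_linear[OF A]] by simp
  ultimately show ?case by blast
qed

text \<open>Continuity of \<open>f t\<close> is known only near the reference pair, so composition
  is possible once all perturbed pairs lie in that neighbourhood. The threshold for \<open>s\<close>
  depends on \<open>t\<close>.\<close>

lemma trajectory_continuous:
  fixes f :: "nat \<Rightarrow> 'x::real_normed_vector \<times> 'u::real_normed_vector \<Rightarrow> 'x" and \<Gamma> :: "'c::topological_space set"
  assumes A: "\<And>t. (f t has_derivative A t) (at (xh t, uh t))"
    and xh: "\<And>t. xh (Suc t) = f t (xh t, uh t)"
    and \<omega>: "\<And>t. bounded ((\<lambda>c. \<omega> c t) ` \<Gamma>)" "\<And>t. continuous_on \<Gamma> (\<lambda>c. \<omega> c t)"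
    and f: "\<And>t. continuous_near (f t) (xh t, uh t)"
  defines "x \<equiv> \<lambda>s c. trajectory f (xh 0) (\<lambda>t. uh t + s *\<^sub>R \<omega> c t)"
  shows "\<forall>\<^sub>F s in at_right 0. continuous_on \<Gamma> (\<lambda>c. x s c t)"
proof (induction t)
  case 0
  show ?case by (simp add: x_def)
next
  case (Suc t)
  let ?y = "\<lambda>c. trajectory A 0 (\<omega> c)"
  let ?q = "\<lambda>s c. ((1 / s) *\<^sub>R (x s c t - xh t), \<omega> c t)" and ?lq = "\<lambda>c. (?y c t, \<omega> c t)"
  have lim: "bounded ((\<lambda>c. ?y c t) ` \<Gamma>) \<and>
      uniform_limit \<Gamma> (\<lambda>s c. (1 / s) *\<^sub>R (x s c t - xh t)) (\<lambda>c. ?y c t) (at_right 0)"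
    unfolding x_def by (rule trajectory_uniform_limit[where f = f and A = A and xh = xh and uh = uh and \<omega> = \<omega> and \<Gamma> = \<Gamma>, OF A xh \<omega>(1)])
  have "bounded (((\<lambda>c. ?y c t) ` \<Gamma>) \<times> ((\<lambda>c. \<omega> c t) ` \<Gamma>))"
    using lim \<omega> by (intro bounded_Times) auto
  then have bq: "bounded (?lq ` \<Gamma>)"
    by (rule bounded_subset) auto
  have q: "uniform_limit \<Gamma> ?q ?lq (at_right 0)"
    using lim by (intro uniform_limit_Pair uniform_limit_const) auto
  obtain W where W: "open W" "(xh t, uh t) \<in> W" "continuous_on W (f t)"
    using f unfolding continuous_near_def by blast
  from uniform_limit_eventually_open[OF q bq W(1,2)] Suc eventually_at_right_less[of 0]
  show ?case
  proof eventually_elim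
    case (elim s)
    then have "(\<lambda>c. (x s c t, uh t + s *\<^sub>R \<omega> c t)) ` \<Gamma> \<subseteq> W" by auto
    moreover have "continuous_on \<Gamma> (\<lambda>c. (x s c t, uh t + s *\<^sub>R \<omega> c t))"
      using elim \<omega>(2) by (intro continuous_intros) auto
    ultimately have "continuous_on \<Gamma> (\<lambda>c. f t (x s c t, uh t + s *\<^sub>R \<omega> c t))"
      using continuous_on_compose2[OF W(3)] by blast
    then show ?case by (simp add: x_def)
  qed
qed

lemma trajectory_linear_combination:
  fixes A :: "nat \<Rightarrow> 'x::real_vector \<times> 'u::real_vector \<Rightarrow> 'x"
  assumes A: "\<And>t. linear (A t)"
  shows "trajectory A 0 (\<lambda>t. a *\<^sub>R v t + b *\<^sub>R w t) t = a *\<^sub>R trajectory A 0 v t + b *\<^sub>R trajectory A 0 w t"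
proof (induction t)
  case (Suc t)
  have "(a *\<^sub>R trajectory A 0 v t + b *\<^sub>R trajectory A 0 w t, a *\<^sub>R v t + b *\<^sub>R w t)
     = a *\<^sub>R (trajectory A 0 v t, v t) + b *\<^sub>R (trajectory A 0 w t, w t)" by simp
  with Suc show ?case
    by (simp only: trajectory.simps linear_add[OF A] linear_cmul[OF A])
qed simp

lemma trajectory_sum:
  fixes A :: "nat \<Rightarrow> 'x::real_vector \<times> 'u::real_vector \<Rightarrow> 'x"
  assumes A: "\<And>t. linear (A t)"
  shows "trajectory A 0 (\<lambda>t. \<Sum>i\<in>I. c i *\<^sub>R w i t) t = (\<Sum>i\<in>I. c i *\<^sub>R trajectory A 0 (w i) t)"
proof (induction t)
  case (Suc t)
  have "(\<Sum>i\<in>I. c i *\<^sub>R trajectory A 0 (w i) t, \<Sum>i\<in>I. c i *\<^sub>R w i t)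
     = (\<Sum>i\<in>I. c i *\<^sub>R (trajectory A 0 (w i) t, w i t))"
    by (simp add: sum_prod)
  with Suc show ?case
    by (simp only: trajectory.simps linear_sum[OF A] linear_cmul[OF A])
qed simp

section \<open>Systems of covectors\<close>

text \<open>The Riesz representative; it carries questions about covectors to a euclidean space,
  where separation is expressed by the inner product.\<close>

definition covector_vec :: "('a::euclidean_space \<Rightarrow>\<^sub>L real) \<Rightarrow> 'a" where
  "covector_vec w = (\<Sum>b\<in>Basis. blinfun_apply w b *\<^sub>R b)"

lemma inner_covector_vec: "covector_vec w \<bullet> v = blinfun_apply w v"
proof -
  have "blinfun_apply w v = blinfun_apply w (\<Sum>b\<in>Basis. (v \<bullet> b) *\<^sub>R b)"
    by (simp add: euclidean_representation)
  also have "\<dots> = covector_vec w \<bullet> v"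
    unfolding covector_vec_def blinfun.sum_right blinfun.scaleR_right inner_sum_left
    by (intro sum.cong) (simp_all add: inner_commute mult.commute)
  finally show ?thesis by simp
qed

lemma linear_covector_vec: "linear covector_vec"
  by (rule linearI)
    (simp_all add: covector_vec_def blinfun.add_left blinfun.scaleR_left scaleR_add_left sum.distrib scaleR_sum_right)

lemma inj_covector_vec: "inj covector_vec"
  by (rule injI, rule blinfun_eqI) (metis inner_covector_vec)

text \<open>Finitely generated cones are closed. Were \<open>- \<psi>\<close> outside the cone
  generated by all \<open>E j\<close>, \<open>- E j\<close> and \<open>G k\<close>, a separating
  vector would satisfy the constraints on \<open>v\<close> and make \<open>\<psi>\<close> positive.
  Generators of both signs leave the multipliers \<open>l\<close> free.\<close>

lemma covector_farkas:
  fixes \<psi> :: "'a::euclidean_space \<Rightarrow>\<^sub>L real"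
  assumes fin: "finite I" "finite K"
    and \<psi>: "\<And>v. (\<And>j. j \<in> I \<Longrightarrow> blinfun_apply (E j) v = 0) \<Longrightarrow>
      (\<And>k. k \<in> K \<Longrightarrow> blinfun_apply (G k) v \<ge> 0) \<Longrightarrow> blinfun_apply \<psi> v \<le> 0"
  obtains l m where "\<And>k. k \<in> K \<Longrightarrow> m k \<ge> 0"
    "\<psi> + (\<Sum>j\<in>I. l j *\<^sub>R E j) + (\<Sum>k\<in>K. m k *\<^sub>R G k) = 0"
proof -
  define S where "S = covector_vec ` (E ` I \<union> uminus ` E ` I \<union> G ` K)"
  define T where "T = {covector_vec ((\<Sum>j\<in>I. l j *\<^sub>R E j) + (\<Sum>k\<in>K. m k *\<^sub>R G k)) |l m. \<forall>k\<in>K. m k \<ge> (0::real)}"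
  have "convex_cone T"
    unfolding convex_cone_iff
  proof (intro conjI ballI allI impI)
    have "0 = covector_vec ((\<Sum>j\<in>I. 0 *\<^sub>R E j) + (\<Sum>k\<in>K. 0 *\<^sub>R G k))"
      by (simp add: linear_0[OF linear_covector_vec])
    then show "0 \<in> T"
      unfolding T_def by fastforce
  next
    fix x y assume "x \<in> T" "y \<in> T"
    then obtain l m l' m' where
      xy: "x = covector_vec ((\<Sum>j\<in>I. l j *\<^sub>R E j) + (\<Sum>k\<in>K. m k *\<^sub>R G k))" "\<forall>k\<in>K. m k \<ge> 0"
      "y = covector_vec ((\<Sum>j\<in>I. l' j *\<^sub>R E j) + (\<Sum>k\<in>K. m' k *\<^sub>R G k))" "\<forall>k\<in>K. m' k \<ge> 0"
      unfolding T_def by blast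
    then show "x + y \<in> T"
      unfolding T_def
      by (intro CollectI exI[of _ "\<lambda>j. l j + l' j"] exI[of _ "\<lambda>k. m k + m' k"])
        (simp add: linear_add[OF linear_covector_vec, symmetric] scaleR_add_left sum.distrib ac_simps)
  next
    fix x and c :: real assume "x \<in> T" "c \<ge> 0"
    then obtain l m where
      "x = covector_vec ((\<Sum>j\<in>I. l j *\<^sub>R E j) + (\<Sum>k\<in>K. m k *\<^sub>R G k))" "\<forall>k\<in>K. m k \<ge> 0"
      unfolding T_def by blast
    with \<open>c \<ge> 0\<close> show "c *\<^sub>R x \<in> T"
      unfolding T_def
      by (intro CollectI exI[of _ "\<lambda>j. c * l j"] exI[of _ "\<lambda>k. c * m k"])
        (simp add: linear_cmul[OF linear_covector_vec, symmetric] scaleR_add_right scaleR_sum_right)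
  qed
  moreover have "S \<subseteq> T"
  proof
    fix x assume "x \<in> S"
    then consider j a where "j \<in> I" "a \<in> {1, -1::real}" "x = covector_vec (a *\<^sub>R E j)"
      | k where "k \<in> K" "x = covector_vec (G k)"
      unfolding S_def by force
    then show "x \<in> T"
    proof cases
      case 1
      have "(\<Sum>i\<in>I. (if i = j then a else 0) *\<^sub>R E i) = a *\<^sub>R E j"
        using 1 fin by (simp add: if_distrib[of "\<lambda>r. r *\<^sub>R _"] cong: if_cong)
      then show ?thesis
        unfolding T_def 1
        by (intro CollectI exI[of _ "\<lambda>i. if i = j then a else 0"] exI[of _ "\<lambda>_. 0"]) simp
    next
      case 2
      have "(\<Sum>i\<in>K. (if i = k then 1 else 0) *\<^sub>R G i) = G k"
        using 2 fin by (simp add: if_distrib[of "\<lambda>r. r *\<^sub>R _"] cong: if_cong)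
      then show ?thesis
        unfolding T_def 2
        by (intro CollectI exI[of _ "\<lambda>_. 0"] exI[of _ "\<lambda>i. if i = k then 1 else 0"]) simp
    qed
  qed
  ultimately have ST: "convex_cone hull S \<subseteq> T"
    by (simp add: hull_minimal)
  have "covector_vec (- \<psi>) \<in> convex_cone hull S"
  proof (rule ccontr)
    assume "covector_vec (- \<psi>) \<notin> convex_cone hull S"
    moreover have "closed (convex_cone hull S)"
      using fin by (intro closed_convex_cone_hull) (auto simp: S_def)
    ultimately obtain a b where ab: "a \<bullet> covector_vec (- \<psi>) < b" "\<And>x. x \<in> convex_cone hull S \<Longrightarrow> a \<bullet> x > b"
      using separating_hyperplane_closed_point[OF convex_convex_cone_hull] by metis
    have "b < 0"
      using ab(2)[OF convex_cone_hull_contains_0] by simp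
    have pos: "a \<bullet> x \<ge> 0" if "x \<in> S" for x
    proof (rule ccontr)
      assume neg: "\<not> a \<bullet> x \<ge> 0"
      \<comment> \<open>The factor puts the point on the hyperplane
        \<open>a \<bullet> x = b\<close>, which the cone avoids.\<close>
      have "(b / (a \<bullet> x)) *\<^sub>R x \<in> convex_cone hull S"
        using that neg \<open>b < 0\<close> by (intro convex_cone_hull_mul hull_inc) (auto intro: divide_nonpos_nonpos)
      from ab(2)[OF this] neg show False by simp
    qed
    have "blinfun_apply \<psi> a \<le> 0"
    proof (rule \<psi>)
      show "blinfun_apply (E j) a = 0" if "j \<in> I" for j
        using pos[of "covector_vec (E j)"] pos[of "covector_vec (- E j)"] that
        by (simp add: S_def inner_commute[of a] inner_covector_vec blinfun.minus_left)
      show "blinfun_apply (G k) a \<ge> 0" if "k \<in> K" for k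
        using pos[of "covector_vec (G k)"] that
        by (simp add: S_def inner_commute[of a] inner_covector_vec)
    qed
    with ab(1) \<open>b < 0\<close> show False
      by (simp add: inner_commute[of a] inner_covector_vec blinfun.minus_left)
  qed
  with ST obtain l m where "\<forall>k\<in>K. m k \<ge> 0"
    "covector_vec (- \<psi>) = covector_vec ((\<Sum>j\<in>I. l j *\<^sub>R E j) + (\<Sum>k\<in>K. m k *\<^sub>R G k))"
    unfolding T_def by blast
  then have "- \<psi> = (\<Sum>j\<in>I. l j *\<^sub>R E j) + (\<Sum>k\<in>K. m k *\<^sub>R G k)"
    by (simp add: inj_eq[OF inj_covector_vec])
  then have "\<psi> + (\<Sum>j\<in>I. l j *\<^sub>R E j) + (\<Sum>k\<in>K. m k *\<^sub>R G k) = 0"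
    by (metis add.assoc add.right_inverse)
  with that \<open>\<forall>k\<in>K. m k \<ge> 0\<close> show ?thesis by blast
qed

text \<open>A linear functional bounded above on a subspace vanishes there. Separating the span from
  the compact hull thus yields a vector that annihilates every \<open>E j\<close> and has a positive
  lower bound on the hull.\<close>

lemma covector_strict_direction:
  fixes E :: "'j \<Rightarrow> 'a::euclidean_space \<Rightarrow>\<^sub>L real" and G :: "'k \<Rightarrow> 'a \<Rightarrow>\<^sub>L real"
  assumes "finite K" and disj: "span (E ` I) \<inter> convex hull (G ` K) = {}"
  obtains v where "\<And>j. j \<in> I \<Longrightarrow> blinfun_apply (E j) v = 0" "\<And>k. k \<in> K \<Longrightarrow> blinfun_apply (G k) v > 0"
proof (cases "K = {}")
  case True
  then show ?thesis using that[of 0] by simp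
next
  case False
  let ?E = "covector_vec ` E ` I" and ?G = "covector_vec ` G ` K"
  have "span ?E \<inter> convex hull ?G = {}"
    using disj inj_covector_vec
    by (simp add: linear_span_image[OF linear_covector_vec] convex_hull_linear_image[OF linear_covector_vec, symmetric]
        image_Int[OF inj_covector_vec, symmetric])
  moreover have "compact (convex hull ?G)" "convex hull ?G \<noteq> {}"
    using assms False by (auto intro: finite_imp_compact_convex_hull)
  ultimately obtain a b where ab: "\<And>x. x \<in> span ?E \<Longrightarrow> a \<bullet> x < b" "\<And>x. x \<in> convex hull ?G \<Longrightarrow> a \<bullet> x > b"
    using separating_hyperplane_closed_compact[of "span ?E" "convex hull ?G"]
    by (metis closed_span convex_convex_hull subspace_imp_convex subspace_span)
  have "b > 0" using ab(1)[OF span_zero] by simp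
  show ?thesis
  proof (rule that[of a])
    show "blinfun_apply (G k) a > 0" if "k \<in> K" for k
      using ab(2)[of "covector_vec (G k)"] that \<open>b > 0\<close>
      by (simp add: hull_inc inner_commute[of a] inner_covector_vec)
    show "blinfun_apply (E j) a = 0" if "j \<in> I" for j
    proof (rule ccontr)
      assume nz: "blinfun_apply (E j) a \<noteq> 0"
      have "(b / blinfun_apply (E j) a) *\<^sub>R covector_vec (E j) \<in> span ?E"
        using that by (intro span_mul span_base) auto
      from ab(1)[OF this] nz show False
        by (simp add: inner_commute[of a] inner_covector_vec)
    qed
  qed
qed

text \<open>Coordinate functionals of an independent family extend to the whole space, and a
  functional on covectors is evaluation at a vector. To first order \<open>d j\<close> moves the
  \<open>j\<close>-th equality constraint alone.\<close>

lemma covector_dual_family: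
  fixes E :: "'j \<Rightarrow> 'a::euclidean_space \<Rightarrow>\<^sub>L real"
  assumes inj: "inj_on E I" and ind: "independent (E ` I)"
  obtains d where "\<And>i j. i \<in> I \<Longrightarrow> j \<in> I \<Longrightarrow> blinfun_apply (E i) (d j) = (if i = j then 1 else 0)"
proof -
  have "independent (covector_vec ` E ` I)"
    using linear_independent_injective_image[OF linear_covector_vec ind] inj_on_subset[OF inj_covector_vec]
    by blast
  then have "\<exists>h::'a \<Rightarrow> real. linear h \<and> (\<forall>x\<in>covector_vec ` E ` I. h x = (if x = covector_vec (E j) then 1 else 0))" for j
    by (rule linear_independent_extend)
  then obtain h :: "'j \<Rightarrow> 'a \<Rightarrow> real" where h: "\<And>j. linear (h j)"
    "\<And>i j. i \<in> I \<Longrightarrow> h j (covector_vec (E i)) = (if covector_vec (E i) = covector_vec (E j) then 1 else 0)"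
    by (metis imageI)
  show ?thesis
  proof (rule that)
    fix i j assume ij: "i \<in> I" "j \<in> I"
    have "h j (covector_vec (E i)) = blinfun_apply (E i) (\<Sum>b\<in>Basis. h j b *\<^sub>R b)"
      by (simp add: covector_vec_def linear_sum[OF h(1)] linear_cmul[OF h(1)] blinfun.sum_right
          blinfun.scaleR_right mult.commute)
    then show "blinfun_apply (E i) (\<Sum>b\<in>Basis. h j b *\<^sub>R b) = (if i = j then 1 else 0)"
      using h(2)[OF ij(1), of j] ij inj by (auto simp: inj_eq[OF inj_covector_vec] inj_on_eq_iff)
  qed
qed

section \<open>Extremal processes\<close>

text \<open>The three criteria survive only in \<open>opt\<close>, a comparison of finite sums with
  processes that rejoin the reference. \<open>A\<close>, \<open>P\<close>, \<open>E\<close> and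
  \<open>G\<close> are differentials at the reference process; for \<open>G\<close> this is asked at
  active indices, while \<open>g_lsc\<close> governs the others.\<close>

locale extremal_process =
  fixes X :: "nat \<Rightarrow> 'x::euclidean_space set" and U :: "nat \<Rightarrow> 'u::euclidean_space set"
    and f :: "nat \<Rightarrow> 'x \<times> 'u \<Rightarrow> 'x" and \<phi> :: "nat \<Rightarrow> 'x \<times> 'u \<Rightarrow> real"
    and g e :: "nat \<Rightarrow> nat \<Rightarrow> 'u \<Rightarrow> real" and mi me :: nat
    and xh :: "nat \<Rightarrow> 'x" and uh :: "nat \<Rightarrow> 'u"
    and A :: "nat \<Rightarrow> 'x \<times> 'u \<Rightarrow> 'x" and P :: "nat \<Rightarrow> 'x \<times> 'u \<Rightarrow> real"
    and E G :: "nat \<Rightarrow> nat \<Rightarrow> 'u \<Rightarrow>\<^sub>L real"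
  assumes f: "\<And>t. f t \<in> X t \<times> U t \<rightarrow> X (Suc t)"
    and U: "\<And>t u. u \<in> U t \<longleftrightarrow> (\<forall>k\<in>{1..mi}. g t k u \<ge> 0) \<and> (\<forall>j\<in>{1..me}. e t j u = 0)"
    and adm: "\<And>t. xh t \<in> X t" "\<And>t. uh t \<in> U t" "\<And>t. xh (Suc t) = f t (xh t, uh t)"
    and opt: "\<And>h x u. x 0 = xh 0 \<Longrightarrow> (\<And>t. x t \<in> X t) \<Longrightarrow> (\<And>t. u t \<in> U t) \<Longrightarrow>
      (\<And>t. x (Suc t) = f t (x t, u t)) \<Longrightarrow> (\<And>t. t > h \<Longrightarrow> x t = xh t \<and> u t = uh t) \<Longrightarrow>
      (\<Sum>t\<le>h. \<phi> t (x t, u t)) \<le> (\<Sum>t\<le>h. \<phi> t (xh t, uh t))"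
    and A: "\<And>t. (f t has_derivative A t) (at (xh t, uh t))"
    and f_cont: "\<And>t. continuous_near (f t) (xh t, uh t)"
    and P: "\<And>t. (\<phi> t has_derivative P t) (at (xh t, uh t))"
    and E: "\<And>t j. j \<in> {1..me} \<Longrightarrow> (e t j has_derivative blinfun_apply (E t j)) (at (uh t))"
    and e_cont: "\<And>t j. j \<in> {1..me} \<Longrightarrow> continuous_near (e t j) (uh t)"
    and G: "\<And>t k. k \<in> {1..mi} \<Longrightarrow> g t k (uh t) = 0 \<Longrightarrow> (g t k has_derivative blinfun_apply (G t k)) (at (uh t))"
    and g_lsc: "\<And>t k. k \<in> {1..mi} \<Longrightarrow> g t k (uh t) > 0 \<Longrightarrow> lsc_at (g t k) (uh t)"
begin

definition active :: "nat \<Rightarrow> nat set" where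
  "active t = {k \<in> {1..mi}. g t k (uh t) = 0}"

text \<open>Inactive inequalities are absent because lower semicontinuity keeps them positive along
  short displacements. As soon as some inequality is active, 0 is excluded.\<close>

definition strict_cone :: "nat \<Rightarrow> 'u set" where
  "strict_cone t = {v. (\<forall>j\<in>{1..me}. E t j v = 0) \<and> (\<forall>k\<in>active t. G t k v > 0)}"

definition payoff :: "nat \<Rightarrow> (nat \<Rightarrow> 'u) \<Rightarrow> real" where
  "payoff h v = (\<Sum>t\<le>h. P t (trajectory A 0 v t, v t))"

lemma linA: "linear (A t)" and linP: "linear (P t)"
  using has_derivative_bounded_linear[OF A] has_derivative_bounded_linear[OF P]
  by (auto simp: bounded_linear.linear)

lemma trajectory_perturbation:
  "trajectory A 0 (\<lambda>t. v t + (\<Sum>i\<in>I. a i *\<^sub>R w i t)) t = trajectory A 0 v t + (\<Sum>i\<in>I. a i *\<^sub>R trajectory A 0 (w i) t)"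
  using trajectory_linear_combination[of A 1 v 1 "\<lambda>t. \<Sum>i\<in>I. a i *\<^sub>R w i t" t] trajectory_sum[of A a w I t] linA
  by simp

lemma payoff_perturbation:
  "payoff h (\<lambda>t. v t + (\<Sum>i\<in>I. a i *\<^sub>R w i t)) = payoff h v + (\<Sum>i\<in>I. a i * payoff h (w i))"
proof -
  have "P t (trajectory A 0 (\<lambda>t. v t + (\<Sum>i\<in>I. a i *\<^sub>R w i t)) t, v t + (\<Sum>i\<in>I. a i *\<^sub>R w i t))
      = P t (trajectory A 0 v t, v t) + (\<Sum>i\<in>I. a i * P t (trajectory A 0 (w i) t, w i t))" for t
  proof -
    have "(trajectory A 0 v t + (\<Sum>i\<in>I. a i *\<^sub>R trajectory A 0 (w i) t), v t + (\<Sum>i\<in>I. a i *\<^sub>R w i t))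
        = (trajectory A 0 v t, v t) + (\<Sum>i\<in>I. a i *\<^sub>R (trajectory A 0 (w i) t, w i t))"
      by (simp add: sum_prod)
    then show ?thesis
      unfolding trajectory_perturbation by (simp only: linear_add[OF linP] linear_sum[OF linP] linear_cmul[OF linP]) simp
  qed
  then show ?thesis
    by (simp add: payoff_def sum.distrib sum_distrib_left sum.swap[of _ I])
qed

text \<open>One index per scalar equation to be met exactly: \<open>Inl (t, j)\<close> for the
  control constraint \<open>e t j\<close>, \<open>Inr b\<close> for a coordinate of the terminal
  state. \<open>constraint\<close> gives the linearized equations.\<close>

definition indices :: "nat \<Rightarrow> ((nat \<times> nat) + 'x) set" where
  "indices h = ({..h} \<times> {1..me}) <+> Basis"

definition constraint :: "nat \<Rightarrow> (nat \<times> nat) + 'x \<Rightarrow> (nat \<Rightarrow> 'u) \<Rightarrow> real" where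
  "constraint h i v = (case i of Inl (t, j) \<Rightarrow> E t j (v t) | Inr b \<Rightarrow> trajectory A 0 v (Suc h) \<bullet> b)"

lemma constraint_perturbation:
  "constraint h i (\<lambda>t. v t + (\<Sum>i\<in>I. a i *\<^sub>R w i t)) = constraint h i v + (\<Sum>k\<in>I. a k * constraint h i (w k))"
  by (auto simp: constraint_def trajectory_perturbation blinfun.add_right blinfun.sum_right blinfun.scaleR_right
      inner_add_left inner_sum_left simp del: trajectory.simps split: sum.split)

lemma finite_indices: "finite (indices h)"
  by (simp add: indices_def)

text \<open>Brouwer's theorem turns the linearized improvement \<open>v\<close> into a genuine one: the coefficients of the
  directions \<open>w i\<close> are adjusted until all equality constraints and the terminal condition hold exactly.\<close>

lemma no_linearized_improvement:
  assumes v: "\<And>t. t \<le> h \<Longrightarrow> v t \<in> strict_cone t" "payoff h v > 0" "trajectory A 0 v (Suc h) = 0"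
    and w: "\<And>i k. i \<in> indices h \<Longrightarrow> k \<in> indices h \<Longrightarrow> constraint h i (w k) = (if i = k then 1 else 0)"
  shows False
proof -
  let ?I = "indices h"
  let ?\<Gamma> = "unit_cube ?I"
  have cv: "constraint h i v = 0" if "i \<in> ?I" for i
    using that v by (auto simp: indices_def constraint_def strict_cone_def simp del: trajectory.simps)
  \<comment> \<open>\<open>M l\<close> bounds the change that corrections with coefficients in the
    unit cube can cause in a linear functional \<open>l\<close>.\<close>
  define M where "M l = (\<Sum>i\<in>?I. \<bar>l (w i)\<bar>)" for l :: "(nat \<Rightarrow> 'u) \<Rightarrow> real"
  have ev: "\<forall>\<^sub>F \<epsilon> in at_right 0. \<epsilon> * M l < l v" if "l v > 0" for l
  proof -
    have "((\<lambda>\<epsilon>. \<epsilon> * M l) \<longlongrightarrow> 0 * M l) (at_right 0)"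
      by (intro tendsto_intros)
    then show ?thesis using that by (intro order_tendstoD(2)) auto
  qed
  have fin: "finite (Sigma {..h} active)"
    by (auto simp: active_def)
  have "\<forall>\<^sub>F \<epsilon> in at_right 0. \<epsilon> > 0 \<and> \<epsilon> * M (payoff h) < payoff h v \<and>
      (\<forall>(t, k)\<in>Sigma {..h} active. \<epsilon> * M (\<lambda>v. G t k (v t)) < G t k (v t))"
    using v ev[of "payoff h"] ev[of "\<lambda>v. G _ _ (v _)"]
    by (intro eventually_conj eventually_at_right_less eventually_ball_finite[OF fin])
      (auto simp: strict_cone_def)
  then obtain \<epsilon> where \<epsilon>: "\<epsilon> > 0" "\<epsilon> * M (payoff h) < payoff h v"
    "\<And>t k. t \<le> h \<Longrightarrow> k \<in> active t \<Longrightarrow> \<epsilon> * M (\<lambda>v. G t k (v t)) < G t k (v t)"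
    using eventually_happens'[OF trivial_limit_at_right_real] by (smt (verit) SigmaI atMost_iff case_prodD)
  \<comment> \<open>The factor \<open>\<epsilon>\<close>, fixed before the step \<open>s\<close>, is
    so small that the strict inequalities of \<open>v\<close> persist for every \<open>c\<close> in
    the cube.\<close>
  define \<omega> where "\<omega> c t = v t + (\<Sum>i\<in>?I. (\<epsilon> * c i) *\<^sub>R w i t)" for c t
  then have \<omega>_eq: "\<omega> c = (\<lambda>t. v t + (\<Sum>i\<in>?I. (\<epsilon> * c i) *\<^sub>R w i t))" for c
    by (simp add: fun_eq_iff)
  have lower: "l v + (\<Sum>i\<in>?I. \<epsilon> * c i * l (w i)) \<ge> l v - \<epsilon> * M l" if "c \<in> ?\<Gamma>" for l c
  proof -
    have "\<bar>\<Sum>i\<in>?I. \<epsilon> * c i * l (w i)\<bar> \<le> (\<Sum>i\<in>?I. \<epsilon> * \<bar>l (w i)\<bar>)"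
      using that \<epsilon>(1)
      by (intro order_trans[OF sum_abs] sum_mono) (auto simp: abs_mult unit_cube_def mult_left_le_one_le)
    then show ?thesis by (simp add: M_def sum_distrib_left)
  qed
  have \<omega>_bdd: "bounded ((\<lambda>c. \<omega> c t) ` ?\<Gamma>)" for t
  proof (rule boundedI)
    fix x assume "x \<in> (\<lambda>c. \<omega> c t) ` ?\<Gamma>"
    then obtain c where c: "c \<in> ?\<Gamma>" "x = \<omega> c t" by blast
    have "norm (\<Sum>i\<in>?I. (\<epsilon> * c i) *\<^sub>R w i t) \<le> (\<Sum>i\<in>?I. \<epsilon> * norm (w i t))"
      using c \<epsilon>(1) by (intro order_trans[OF norm_sum] sum_mono) (auto simp: abs_mult unit_cube_def mult_left_le_one_le mult.assoc)
    then show "norm x \<le> norm (v t) + (\<Sum>i\<in>?I. \<epsilon> * norm (w i t))"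
      unfolding c \<omega>_def by (meson add_left_mono norm_triangle_le)
  qed
  have \<omega>_cont: "continuous_on ?\<Gamma> (\<lambda>c. \<omega> c t)" for t
    unfolding \<omega>_def
    by (intro continuous_intros continuous_on_product_then_coordinatewise continuous_on_id)
  define x where "x s c = trajectory f (xh 0) (\<lambda>t. uh t + s *\<^sub>R \<omega> c t)" for s c
  define y where "y c = trajectory A 0 (\<omega> c)" for c
  have x_lim: "bounded ((\<lambda>c. y c t) ` ?\<Gamma>)"
    "uniform_limit ?\<Gamma> (\<lambda>s c. (1 / s) *\<^sub>R (x s c t - xh t)) (\<lambda>c. y c t) (at_right 0)" for t
    unfolding x_def y_def
    using trajectory_uniform_limit[where f = f and A = A and xh = xh and uh = uh and \<omega> = \<omega> and \<Gamma> = ?\<Gamma>, OF A adm(3) \<omega>_bdd]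
    by blast+
  have x_cont: "\<forall>\<^sub>F s in at_right 0. continuous_on ?\<Gamma> (\<lambda>c. x s c t)" for t
    unfolding x_def
    by (rule trajectory_continuous[where f = f and A = A and xh = xh and uh = uh and \<omega> = \<omega> and \<Gamma> = ?\<Gamma>, OF A adm(3) \<omega>_bdd \<omega>_cont f_cont])
  have u_lim: "uniform_limit ?\<Gamma> (\<lambda>s c. \<omega> c t) (\<lambda>c. \<omega> c t) (at_right 0)" for t
    by (rule uniform_limit_const)
  have e_lim: "uniform_limit ?\<Gamma> (\<lambda>s c. (1 / s) *\<^sub>R (e t j (uh t + s *\<^sub>R \<omega> c t) - e t j (uh t))) (\<lambda>c. E t j (\<omega> c t)) (at_right 0)"
    if "j \<in> {1..me}" for t j
    by (rule has_derivative_uniform_limit[OF E[OF that] u_lim \<omega>_bdd])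
  have e_uh: "e t j (uh t) = 0" if "j \<in> {1..me}" for t j
    using adm(2) U that by blast
  \<comment> \<open>\<open>N s c i\<close> is the exact residual of equation \<open>i\<close> at
    step \<open>s\<close>. To first order it is \<open>s * \<epsilon> * c i\<close>, because
    \<open>v\<close> solves the linearized equations and the \<open>w i\<close> are dual to
    them.\<close>
  define N where "N s c i = (case i of Inl (t, j) \<Rightarrow> e t j (uh t + s *\<^sub>R \<omega> c t)
    | Inr b \<Rightarrow> (x s c (Suc h) - xh (Suc h)) \<bullet> b)" for s c and i :: "(nat \<times> nat) + 'x"
  have con: "constraint h i (\<omega> c) = \<epsilon> * c i" if "i \<in> ?I" for c i
  proof -
    have "constraint h i (\<omega> c) = (\<Sum>k\<in>?I. \<epsilon> * c k * constraint h i (w k))"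
      unfolding \<omega>_eq constraint_perturbation cv[OF that] by simp
    also have "\<dots> = (\<Sum>k\<in>?I. if k = i then \<epsilon> * c i else 0)"
      using w that by (intro sum.cong) auto
    finally show ?thesis using that finite_indices by simp
  qed
  have N_lim: "uniform_limit ?\<Gamma> (\<lambda>s c. N s c i / s) (\<lambda>c. constraint h i (\<omega> c)) (at_right 0)" if "i \<in> ?I" for i
  proof (cases i)
    case (Inl p)
    then obtain t j where i: "i = Inl (t, j)" "j \<in> {1..me}"
      using \<open>i \<in> ?I\<close> by (auto simp: indices_def)
    then show ?thesis
      using e_lim[of j t] e_uh[of j t] by (simp add: N_def constraint_def)
  next
    case (Inr b)
    have "uniform_limit ?\<Gamma> (\<lambda>s c. ((1 / s) *\<^sub>R (x s c (Suc h) - xh (Suc h))) \<bullet> b) (\<lambda>c. y c (Suc h) \<bullet> b) (at_right 0)"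
      by (rule bounded_linear.uniform_limit[OF bounded_linear_inner_left x_lim(2)])
    then show ?thesis
      by (simp add: Inr N_def constraint_def y_def)
  qed
  have N_near: "\<forall>\<^sub>F s in at_right 0. \<forall>c\<in>?\<Gamma>. \<bar>N s c i / s - \<epsilon> * c i\<bar> < \<epsilon>" if "i \<in> ?I" for i
    using uniform_limitD[OF N_lim[OF that] \<epsilon>(1)] con[OF that] by (simp add: dist_real_def)
  have N_cont: "\<forall>\<^sub>F s in at_right 0. continuous_on ?\<Gamma> (\<lambda>c. N s c i)" if "i \<in> ?I" for i
  proof (cases i)
    case (Inl p)
    then obtain t j where i: "i = Inl (t, j)" "j \<in> {1..me}"
      using \<open>i \<in> ?I\<close> by (auto simp: indices_def)
    then obtain W where W: "open W" "uh t \<in> W" "continuous_on W (e t j)"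
      using e_cont unfolding continuous_near_def by blast
    from uniform_limit_eventually_open[OF u_lim[of t] \<omega>_bdd[of t] W(1,2)] show ?thesis
    proof eventually_elim
      case (elim s)
      then have "(\<lambda>c. uh t + s *\<^sub>R \<omega> c t) ` ?\<Gamma> \<subseteq> W" by blast
      moreover have "continuous_on ?\<Gamma> (\<lambda>c. uh t + s *\<^sub>R \<omega> c t)"
        by (intro continuous_intros \<omega>_cont)
      ultimately have "continuous_on ?\<Gamma> (\<lambda>c. e t j (uh t + s *\<^sub>R \<omega> c t))"
        using continuous_on_compose2[OF W(3)] by blast
      then show ?case by (simp add: N_def i)
    qed
  next
    case (Inr b)
    show ?thesis
      using x_cont[of "Suc h"]
      by eventually_elim (simp add: N_def Inr continuous_intros)
  qed
  have g_ev: "\<forall>\<^sub>F s in at_right 0. \<forall>c\<in>?\<Gamma>. g t k (uh t + s *\<^sub>R \<omega> c t) \<ge> 0" if "t \<le> h" "k \<in> {1..mi}" for t k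
  proof (cases "k \<in> active t")
    case True
    then have 0: "g t k (uh t) = 0" by (simp add: active_def)
    have "uniform_limit ?\<Gamma> (\<lambda>s c. (1 / s) *\<^sub>R (g t k (uh t + s *\<^sub>R \<omega> c t) - g t k (uh t))) (\<lambda>c. G t k (\<omega> c t)) (at_right 0)"
      by (rule has_derivative_uniform_limit[OF G[OF that(2) 0] u_lim \<omega>_bdd])
    then have "\<forall>\<^sub>F s in at_right 0. \<forall>c\<in>?\<Gamma>. (1 / s) *\<^sub>R (g t k (uh t + s *\<^sub>R \<omega> c t) - g t k (uh t)) > 0"
    proof (rule uniform_limit_eventually_pos)
      show "G t k (v t) - \<epsilon> * M (\<lambda>v. G t k (v t)) > 0"
        using \<epsilon>(3) that True by simp
      show "G t k (\<omega> c t) \<ge> G t k (v t) - \<epsilon> * M (\<lambda>v. G t k (v t))" if "c \<in> ?\<Gamma>" for c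
        using lower[OF that, of "\<lambda>v. G t k (v t)"]
        by (simp add: \<omega>_def blinfun.add_right blinfun.sum_right blinfun.scaleR_right)
    qed
    with eventually_at_right_less[of "0::real"] show ?thesis
      by eventually_elim (force simp: 0 zero_less_divide_iff)
  next
    case False
    then have pos: "g t k (uh t) > 0"
      using adm(2)[of t] U[of "uh t" t] that by (force simp: active_def)
    then have "\<forall>\<^sub>F u in nhds (uh t). 0 < g t k u"
      using g_lsc that unfolding lsc_at_def by blast
    then obtain W where W: "open W" "uh t \<in> W" "\<And>u. u \<in> W \<Longrightarrow> 0 < g t k u"
      unfolding eventually_nhds by blast
    from uniform_limit_eventually_open[OF u_lim[of t] \<omega>_bdd[of t] W(1,2)] show ?thesis
      by eventually_elim (force dest: W(3))
  qed
  \<comment> \<open>For \<open>s > 0\<close> the argument of \<open>\<phi> t\<close> is the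
    perturbed pair \<open>(x s c t, uh t + s *\<^sub>R \<omega> c t)\<close>, written as base point
    plus step times direction.\<close>
  have \<phi>_lim: "uniform_limit ?\<Gamma> (\<lambda>s c. \<Sum>t\<le>h. (1 / s) *\<^sub>R (\<phi> t ((xh t, uh t) + s *\<^sub>R ((1 / s) *\<^sub>R (x s c t - xh t), \<omega> c t)) - \<phi> t (xh t, uh t)))
      (\<lambda>c. payoff h (\<omega> c)) (at_right 0)"
    unfolding payoff_def
  proof (rule uniform_limit_sum)
    fix t
    have "bounded (((\<lambda>c. y c t) ` ?\<Gamma>) \<times> ((\<lambda>c. \<omega> c t) ` ?\<Gamma>))"
      using x_lim \<omega>_bdd by (intro bounded_Times)
    then have "bounded ((\<lambda>c. (y c t, \<omega> c t)) ` ?\<Gamma>)"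
      by (rule bounded_subset) auto
    from has_derivative_uniform_limit[OF P uniform_limit_Pair[OF x_lim(2) u_lim] this]
    show "uniform_limit ?\<Gamma> (\<lambda>s c. (1 / s) *\<^sub>R (\<phi> t ((xh t, uh t) + s *\<^sub>R ((1 / s) *\<^sub>R (x s c t - xh t), \<omega> c t)) - \<phi> t (xh t, uh t)))
      (\<lambda>c. P t (trajectory A 0 (\<omega> c) t, \<omega> c t)) (at_right 0)"
      by (simp add: y_def)
  qed
  have \<phi>_ev: "\<forall>\<^sub>F s in at_right 0. \<forall>c\<in>?\<Gamma>. (\<Sum>t\<le>h. (1 / s) *\<^sub>R (\<phi> t ((xh t, uh t) + s *\<^sub>R ((1 / s) *\<^sub>R (x s c t - xh t), \<omega> c t)) - \<phi> t (xh t, uh t))) > 0"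
    using \<phi>_lim
  proof (rule uniform_limit_eventually_pos)
    show "payoff h v - \<epsilon> * M (payoff h) > 0" using \<epsilon> by simp
    show "payoff h (\<omega> c) \<ge> payoff h v - \<epsilon> * M (payoff h)" if "c \<in> ?\<Gamma>" for c
      using lower[OF that, of "payoff h"] payoff_perturbation[of h v "\<lambda>i. \<epsilon> * c i" w ?I]
      by (simp add: \<omega>_eq)
  qed
  have "\<forall>\<^sub>F s in at_right 0. s > 0 \<and> (\<forall>i\<in>?I. \<forall>c\<in>?\<Gamma>. \<bar>N s c i / s - \<epsilon> * c i\<bar> < \<epsilon>) \<and>
      (\<forall>i\<in>?I. continuous_on ?\<Gamma> (\<lambda>c. N s c i)) \<and>
      (\<forall>t\<in>{..h}. \<forall>k\<in>{1..mi}. \<forall>c\<in>?\<Gamma>. g t k (uh t + s *\<^sub>R \<omega> c t) \<ge> 0) \<and>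
      (\<forall>c\<in>?\<Gamma>. (\<Sum>t\<le>h. (1 / s) *\<^sub>R (\<phi> t ((xh t, uh t) + s *\<^sub>R ((1 / s) *\<^sub>R (x s c t - xh t), \<omega> c t)) - \<phi> t (xh t, uh t))) > 0)"
  proof (intro eventually_conj eventually_at_right_less \<phi>_ev)
    show "\<forall>\<^sub>F s in at_right 0. \<forall>i\<in>?I. \<forall>c\<in>?\<Gamma>. \<bar>N s c i / s - \<epsilon> * c i\<bar> < \<epsilon>"
      using finite_indices N_near by (rule eventually_ball_finite[OF _ ballI])
    show "\<forall>\<^sub>F s in at_right 0. \<forall>i\<in>?I. continuous_on ?\<Gamma> (\<lambda>c. N s c i)"
      using finite_indices N_cont by (rule eventually_ball_finite[OF _ ballI])
    show "\<forall>\<^sub>F s in at_right 0. \<forall>t\<in>{..h}. \<forall>k\<in>{1..mi}. \<forall>c\<in>?\<Gamma>. g t k (uh t + s *\<^sub>R \<omega> c t) \<ge> 0"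
      by (intro eventually_ball_finite[OF finite_atMost] eventually_ball_finite[OF finite_atLeastAtMost] ballI g_ev) auto
  qed
  then obtain s where s: "s > 0" "\<And>i c. i \<in> ?I \<Longrightarrow> c \<in> ?\<Gamma> \<Longrightarrow> \<bar>N s c i / s - \<epsilon> * c i\<bar> < \<epsilon>"
    "\<And>i. i \<in> ?I \<Longrightarrow> continuous_on ?\<Gamma> (\<lambda>c. N s c i)"
    "\<And>t k c. t \<le> h \<Longrightarrow> k \<in> {1..mi} \<Longrightarrow> c \<in> ?\<Gamma> \<Longrightarrow> g t k (uh t + s *\<^sub>R \<omega> c t) \<ge> 0"
    "\<And>c. c \<in> ?\<Gamma> \<Longrightarrow> (\<Sum>t\<le>h. (1 / s) *\<^sub>R (\<phi> t ((xh t, uh t) + s *\<^sub>R ((1 / s) *\<^sub>R (x s c t - xh t), \<omega> c t)) - \<phi> t (xh t, uh t))) > 0"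
    using eventually_happens'[OF trivial_limit_at_right_real] by (smt (verit) atMost_iff)
  \<comment> \<open>Division by \<open>s * \<epsilon>\<close> makes the residual a map within 1 of
    the identity; its zero is the exact correction.\<close>
  have "\<exists>c\<in>?\<Gamma>. \<forall>i\<in>?I. N s c i / (s * \<epsilon>) = 0"
  proof (rule near_identity_zero[OF finite_indices])
    show "continuous_on ?\<Gamma> (\<lambda>c. N s c i / (s * \<epsilon>))" if "i \<in> ?I" for i
      using s \<epsilon> that by (intro continuous_intros) auto
    show "\<bar>N s c i / (s * \<epsilon>) - c i\<bar> \<le> 1" if "c \<in> ?\<Gamma>" "i \<in> ?I" for c i
    proof -
      have "N s c i / (s * \<epsilon>) - c i = (N s c i / s - \<epsilon> * c i) / \<epsilon>"
        using s \<epsilon> by (simp add: field_simps)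
      then show ?thesis using s(2)[OF that(2,1)] \<epsilon> by simp
    qed
  qed
  then obtain c where c: "c \<in> ?\<Gamma>" "\<And>i. i \<in> ?I \<Longrightarrow> N s c i = 0"
    using s(1) \<epsilon>(1) by auto
  \<comment> \<open>The reference controls are resumed after \<open>h\<close>; as the state is then
    back at \<open>xh (Suc h)\<close>, it stays on the reference trajectory.\<close>
  define u where "u t = (if t \<le> h then uh t + s *\<^sub>R \<omega> c t else uh t)" for t
  define z where "z = trajectory f (xh 0) u"
  have z_eq: "z t = x s c t" if "t \<le> Suc h" for t
    unfolding z_def x_def using that by (intro trajectory_cong) (auto simp: u_def)
  have "x s c (Suc h) = xh (Suc h)"
  proof (rule euclidean_eqI)
    fix b :: 'x assume "b \<in> Basis"
    then show "x s c (Suc h) \<bullet> b = xh (Suc h) \<bullet> b"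
      using c(2)[of "Inr b"] by (auto simp: indices_def N_def inner_diff_left)
  qed
  then have z_end: "z (Suc h) = xh (Suc h)" using z_eq by simp
  have z_late: "z t = xh t" if "t \<ge> Suc h" for t
    using that
  proof (induction rule: dec_induct)
    case base
    show ?case by (rule z_end)
  next
    case (step t)
    then show ?case by (simp add: z_def u_def adm(3))
  qed
  have uU: "u t \<in> U t" for t
  proof (cases "t \<le> h")
    case True
    then show ?thesis
      using s(4)[OF _ _ c(1)] c(2)[of "Inl (t, _)"] by (force simp: U u_def indices_def N_def)
  qed (use adm in \<open>simp add: u_def\<close>)
  have zX: "z t \<in> X t" for t
  proof (induction t)
    case (Suc t)
    then show ?case using f[of t] uU[of t] by (auto simp: z_def)
  qed (use adm in \<open>simp add: z_def\<close>)
  have "(\<Sum>t\<le>h. \<phi> t (z t, u t)) \<le> (\<Sum>t\<le>h. \<phi> t (xh t, uh t))"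
  proof (rule opt[OF _ zX uU])
    show "z t = xh t \<and> u t = uh t" if "t > h" for t
      using z_late that by (simp add: u_def)
  qed (simp_all add: z_def)
  moreover have "(\<Sum>t\<le>h. (1 / s) *\<^sub>R (\<phi> t ((xh t, uh t) + s *\<^sub>R ((1 / s) *\<^sub>R (x s c t - xh t), \<omega> c t)) - \<phi> t (xh t, uh t)))
      = (1 / s) * (\<Sum>t\<le>h. \<phi> t (z t, u t) - \<phi> t (xh t, uh t))"
    unfolding sum_distrib_left using s(1) by (intro sum.cong) (auto simp: z_eq u_def)
  ultimately show False
    using s(5)[OF c(1)] s(1) by (simp add: sum_subtractf zero_less_divide_iff)
qed

end

text \<open>\<open>B\<close> expresses (viii) through explicit inverses at the indices
  \<open>Suc t\<close>. The family \<open>d\<close> is to come from (vii), and nonemptiness of the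
  strict cones from (vi).\<close>

locale regular_process = extremal_process +
  fixes A1 :: "nat \<Rightarrow> 'a \<Rightarrow>\<^sub>L 'a" and A2 :: "nat \<Rightarrow> 'b \<Rightarrow>\<^sub>L 'a"
    and P1 :: "nat \<Rightarrow> 'a \<Rightarrow>\<^sub>L real" and P2 :: "nat \<Rightarrow> 'b \<Rightarrow>\<^sub>L real"
    and B :: "nat \<Rightarrow> 'a \<Rightarrow>\<^sub>L 'a" and d :: "nat \<Rightarrow> nat \<Rightarrow> 'b"
  assumes A_split: "\<And>t x v. A t (x, v) = A1 t x + A2 t v"
    and P_split: "\<And>t x v. P t (x, v) = P1 t x + P2 t v"
    and B: "\<And>t. B (Suc t) o\<^sub>L A1 (Suc t) = id_blinfun" "\<And>t. A1 (Suc t) o\<^sub>L B (Suc t) = id_blinfun"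
    and dual: "\<And>t i j. i \<in> {1..me} \<Longrightarrow> j \<in> {1..me} \<Longrightarrow> E t i (d t j) = (if i = j then 1 else 0)"
    and strict_cone_nonempty: "\<And>t. strict_cone t \<noteq> {}"
begin

section \<open>The cone of linearized outcomes and its supporting hyperplane\<close>

definition linearized_outcomes :: "nat \<Rightarrow> (real \<times> 'a) set" where
  "linearized_outcomes h = (\<lambda>v. (payoff h v, trajectory A 0 v (Suc h))) ` {v. \<forall>t\<le>h. v t \<in> strict_cone t}"

lemma payoff_linear_combination:
  "payoff h (\<lambda>t. a *\<^sub>R v t + b *\<^sub>R w t) = a * payoff h v + b * payoff h w"
proof -
  have "P t (trajectory A 0 (\<lambda>t. a *\<^sub>R v t + b *\<^sub>R w t) t, a *\<^sub>R v t + b *\<^sub>R w t)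
      = a * P t (trajectory A 0 v t, v t) + b * P t (trajectory A 0 w t, w t)" for t
    unfolding trajectory_linear_combination[OF linA] P_split
    by (simp add: blinfun.add_right blinfun.scaleR_right algebra_simps)
  then show ?thesis
    by (simp add: payoff_def sum.distrib sum_distrib_left)
qed

lemma strict_cone_combination:
  assumes "v \<in> strict_cone t" "w \<in> strict_cone t" "a \<ge> 0" "b \<ge> 0" "a + b > 0"
  shows "a *\<^sub>R v + b *\<^sub>R w \<in> strict_cone t"
proof -
  have "a * r + b * s > 0" if "r > 0" "s > 0" for r s :: real
    using that assms(3-5) by (cases "a = 0") (auto intro: add_pos_nonneg)
  then show ?thesis
    using assms by (auto simp: strict_cone_def blinfun.add_right blinfun.scaleR_right)
qed

text \<open>Covers convexity and positive scaling together. The coefficients must not both vanish,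
  since the strict cones need not contain 0.\<close>

lemma linearized_outcomes_combination:
  assumes "x \<in> linearized_outcomes h" "y \<in> linearized_outcomes h" "a \<ge> 0" "b \<ge> 0" "a + b > 0"
  shows "a *\<^sub>R x + b *\<^sub>R y \<in> linearized_outcomes h"
proof -
  obtain v w where vw: "\<forall>t\<le>h. v t \<in> strict_cone t" "\<forall>t\<le>h. w t \<in> strict_cone t"
    "x = (payoff h v, trajectory A 0 v (Suc h))" "y = (payoff h w, trajectory A 0 w (Suc h))"
    using assms by (auto simp: linearized_outcomes_def)
  then have "a *\<^sub>R x + b *\<^sub>R y = (payoff h (\<lambda>t. a *\<^sub>R v t + b *\<^sub>R w t), trajectory A 0 (\<lambda>t. a *\<^sub>R v t + b *\<^sub>R w t) (Suc h))"
    unfolding trajectory_linear_combination[OF linA] payoff_linear_combination by simp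
  then show ?thesis
    unfolding linearized_outcomes_def using vw assms by (auto intro!: imageI strict_cone_combination)
qed

lemma strict_cone_selection:
  obtains v where "\<And>t. v t \<in> strict_cone t"
  using that[of "\<lambda>t. SOME v. v \<in> strict_cone t"] strict_cone_nonempty by (simp add: some_in_eq)

lemma linearized_outcomes_nonempty: "linearized_outcomes h \<noteq> {}"
proof -
  obtain v where "\<And>t. v t \<in> strict_cone t"
    using strict_cone_selection by blast
  then show ?thesis by (auto simp: linearized_outcomes_def)
qed

text \<open>Otherwise all terminal variations in a ball around 0 are reached with payoff 1.
  Differences of such controls move the terminal state along each basis vector and respect the
  linearized equalities; together with the vectors \<open>d\<close> they yield a family dual to all
  equations, and \<open>V 0\<close> becomes a forbidden improvement.\<close>

lemma improvement_not_interior: "(1, 0) \<notin> interior (linearized_outcomes h)"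
proof
  assume "(1, 0) \<in> interior (linearized_outcomes h)"
  then obtain r where r: "r > 0" "ball (1, 0) r \<subseteq> linearized_outcomes h"
    by (meson mem_interior)
  have "\<exists>v. (\<forall>t\<le>h. v t \<in> strict_cone t) \<and> payoff h v = 1 \<and> trajectory A 0 v (Suc h) = y" if "norm y < r" for y
  proof -
    have "(1, y) \<in> linearized_outcomes h"
      using that r by (auto simp: dist_norm)
    then show ?thesis by (auto simp: linearized_outcomes_def)
  qed
  then obtain V where V: "\<And>y t. norm y < r \<Longrightarrow> t \<le> h \<Longrightarrow> V y t \<in> strict_cone t"
    "\<And>y. norm y < r \<Longrightarrow> payoff h (V y) = 1" "\<And>y. norm y < r \<Longrightarrow> trajectory A 0 (V y) (Suc h) = y"
    by metis
  define \<delta> where "\<delta> = r / 2"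
  have \<delta>: "\<delta> > 0" "\<delta> < r" using r by (auto simp: \<delta>_def)
  define wx where "wx b t = (1 / \<delta>) *\<^sub>R V (\<delta> *\<^sub>R b) t + (- 1 / \<delta>) *\<^sub>R V 0 t" for b t
  have wx_traj: "trajectory A 0 (wx b) (Suc h) = b" if "b \<in> Basis" for b
  proof -
    have "trajectory A 0 (wx b) (Suc h) = (1 / \<delta>) *\<^sub>R trajectory A 0 (V (\<delta> *\<^sub>R b)) (Suc h) + (- 1 / \<delta>) *\<^sub>R trajectory A 0 (V 0) (Suc h)"
      unfolding trajectory_linear_combination[OF linA, symmetric] wx_def ..
    also have "\<dots> = b"
      using V(3)[of "\<delta> *\<^sub>R b"] V(3)[of 0] that \<delta> r by simp
    finally show ?thesis .
  qed
  have wx_E: "E t j (wx b t) = 0" if "b \<in> Basis" "t \<le> h" "j \<in> {1..me}" for b t j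
    using V(1)[of "\<delta> *\<^sub>R b" t] V(1)[of 0 t] that \<delta> r
    by (simp add: wx_def strict_cone_def blinfun.add_right blinfun.scaleR_right blinfun.diff_right)
  have wx: "constraint h i (wx b) = (if i = Inr b then 1 else 0)" if "i \<in> indices h" "b \<in> Basis" for i b
    using that wx_E wx_traj[OF that(2)]
    by (auto simp: constraint_def indices_def inner_Basis simp del: trajectory.simps split: if_splits)
  \<comment> \<open>An impulse at a single time that moves one control constraint. In
    \<open>w\<close> its effect on the terminal state is cancelled by the
    \<open>wx b\<close>.\<close>
  define z where "z p t = (if t = fst p then d (fst p) (snd p) else 0)" for p :: "nat \<times> nat" and t
  define w where "w k = (case k of Inr b \<Rightarrow> wx b
    | Inl p \<Rightarrow> (\<lambda>t. z p t + (\<Sum>b\<in>Basis. (- (trajectory A 0 (z p) (Suc h) \<bullet> b)) *\<^sub>R wx b t)))" for k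
  show False
  proof (rule no_linearized_improvement)
    show "V 0 t \<in> strict_cone t" if "t \<le> h" for t using V(1)[of 0] that r by simp
    show "payoff h (V 0) > 0" "trajectory A 0 (V 0) (Suc h) = 0"
      using V(2)[of 0] V(3)[of 0] r by simp_all
    fix i k assume i: "i \<in> indices h" and k: "k \<in> indices h"
    show "constraint h i (w k) = (if i = k then 1 else 0)"
    proof (cases k)
      case (Inr b)
      then show ?thesis using wx[OF i, of b] k by (auto simp: w_def indices_def)
    next
      case (Inl p)
      then obtain t j where p: "p = (t, j)" "j \<in> {1..me}" "t \<le> h"
        using k by (auto simp: indices_def)
      have "constraint h i (w k) = constraint h i (z p) + (\<Sum>b\<in>Basis. - (trajectory A 0 (z p) (Suc h) \<bullet> b) * constraint h i (wx b))"
        unfolding w_def Inl sum.case constraint_perturbation ..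
      also have "(\<Sum>b\<in>Basis. - (trajectory A 0 (z p) (Suc h) \<bullet> b) * constraint h i (wx b))
          = (\<Sum>b\<in>Basis. if i = Inr b then - (trajectory A 0 (z p) (Suc h) \<bullet> b) else 0)"
        using wx[OF i] by (intro sum.cong) auto
      also have "constraint h i (z p) + \<dots> = (if i = k then 1 else 0)"
      proof (cases i)
        case i': (Inl p')
        then obtain t' j' where p': "p' = (t', j')" "j' \<in> {1..me}"
          using i by (auto simp: indices_def)
        then show ?thesis
          using Inl i' p dual[of j' j t] by (auto simp: constraint_def z_def)
      next
        case i': (Inr b)
        then have "b \<in> Basis" using i by (auto simp: indices_def)
        then show ?thesis
          using Inl i' by (simp add: constraint_def del: trajectory.simps)
      qed
      finally show ?thesis .
    qed
  qed
qed

text \<open>A cone with empty interior lies in a hyperplane through 0, whose normal can be oriented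
  towards \<open>(1, 0)\<close>; otherwise the interior is separated from \<open>(1, 0)\<close>.
  Scaling inside the cone replaces the separating constant by 0.\<close>

lemma terminal_multiplier:
  obtains l0 q where "(l0, q) \<noteq> (0 :: real, 0 :: 'a)" "l0 \<ge> 0"
    "\<And>v. (\<And>t. t \<le> h \<Longrightarrow> v t \<in> strict_cone t) \<Longrightarrow> l0 * payoff h v + q \<bullet> trajectory A 0 v (Suc h) \<le> 0"
proof -
  let ?K = "linearized_outcomes h"
  have conv: "convex ?K"
    by (auto simp: convex_def intro: linearized_outcomes_combination)
  have scale: "c *\<^sub>R x \<in> ?K" if "c > 0" "x \<in> ?K" for c x
    using linearized_outcomes_combination[OF that(2,2), of "c / 2" "c / 2"] that(1)
    by (simp add: scaleR_add_left[symmetric])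
  obtain a where a: "a \<noteq> 0" "\<And>x. x \<in> ?K \<Longrightarrow> a \<bullet> x \<le> 0" "a \<bullet> (1, 0) \<ge> 0"
  proof (cases "interior ?K = {}")
    case True
    then obtain a b where ab: "a \<noteq> 0" "?K \<subseteq> {x. a \<bullet> x = b}"
      using empty_interior_subset_hyperplane[OF conv] by metis
    obtain x where x: "x \<in> ?K" using linearized_outcomes_nonempty by blast
    have "a \<bullet> x = b" "a \<bullet> (2 *\<^sub>R x) = b"
      using ab(2) x scale[of 2 x] by auto
    then have "b = 0" by simp
    with ab(2) have K0: "a \<bullet> y = 0" if "y \<in> ?K" for y using that by auto
    show ?thesis
    proof (cases "a \<bullet> (1, 0) \<ge> 0")
      case True
      then show ?thesis using that[of a] ab(1) K0 by simp
    next
      case False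
      then show ?thesis using that[of "- a"] ab(1) K0 by simp
    qed
  next
    case False
    have "\<exists>a b. a \<noteq> 0 \<and> (\<forall>x\<in>interior ?K. a \<bullet> x \<le> b) \<and> (\<forall>x\<in>{(1, 0)}. a \<bullet> x \<ge> b)"
      using False improvement_not_interior[of h] by (intro separating_hyperplane_sets convex_interior conv) auto
    then obtain a b where ab: "a \<noteq> 0" "\<And>x. x \<in> interior ?K \<Longrightarrow> a \<bullet> x \<le> b" "a \<bullet> (1, 0) \<ge> b"
      by blast
    have "closure (interior ?K) \<subseteq> {x. a \<bullet> x \<le> b}"
      using ab(2) by (intro closure_minimal closed_halfspace_le) auto
    then have K: "a \<bullet> x \<le> b" if "x \<in> ?K" for x
      using that closure_subset convex_closure_interior[OF conv False] by blast
    have le0: "a \<bullet> x \<le> 0" if x: "x \<in> ?K" for x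
    proof (rule ccontr)
      assume neg: "\<not> a \<bullet> x \<le> 0"
      have "((\<bar>b\<bar> + 1) / (a \<bullet> x)) *\<^sub>R x \<in> ?K"
        using neg x by (intro scale) auto
      from K[OF this] neg show False by simp
    qed
    have "b \<ge> 0"
    proof (rule ccontr)
      assume b: "\<not> b \<ge> 0"
      obtain x where x: "x \<in> ?K" using linearized_outcomes_nonempty by blast
      then have neg: "a \<bullet> x < 0" using K[OF x] b by simp
      \<comment> \<open>This multiple has value \<open>b / 2\<close>, which exceeds the negative
        \<open>b\<close>.\<close>
      have "(b / (2 * (a \<bullet> x))) *\<^sub>R x \<in> ?K"
        using neg x b by (intro scale) (auto simp: zero_less_divide_iff)
      from K[OF this] neg b show False by simp
    qed
    with that[of a] ab le0 show ?thesis by force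
  qed
  show ?thesis
  proof (rule that[of "fst a" "snd a"])
    show "(fst a, snd a) \<noteq> (0, 0)" using a(1) by (auto simp: prod_eq_iff)
    show "fst a \<ge> 0" using a(3) by (simp add: inner_prod_def)
    fix v assume "\<And>t. t \<le> h \<Longrightarrow> v t \<in> strict_cone t"
    then have "(payoff h v, trajectory A 0 v (Suc h)) \<in> ?K"
      by (auto simp: linearized_outcomes_def)
    from a(2)[OF this] show "fst a * payoff h v + snd a \<bullet> trajectory A 0 v (Suc h) \<le> 0"
      by (simp add: inner_prod_def)
  qed
qed

section \<open>Adjoint variables and the passage to the infinite horizon\<close>

text \<open>\<open>costate l0 p t\<close> is the adjoint variable of index \<open>t + 1\<close>.\<close>

primrec costate :: "real \<Rightarrow> ('a \<Rightarrow>\<^sub>L real) \<Rightarrow> nat \<Rightarrow> ('a \<Rightarrow>\<^sub>L real)" where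
  "costate l0 p 0 = p"
| "costate l0 p (Suc t) = (costate l0 p t - l0 *\<^sub>R P1 (Suc t)) o\<^sub>L B (Suc t)"

text \<open>This is (AE) at index \<open>t + 1\<close>. The recursion is that equation solved for
  the later costate; \<open>B\<close> as a left inverse undoes the solving.\<close>

lemma costate_adjoint: "costate l0 p t = (costate l0 p (Suc t) o\<^sub>L A1 (Suc t)) + l0 *\<^sub>R P1 (Suc t)"
proof -
  have "blinfun_apply (B (Suc t)) (blinfun_apply (A1 (Suc t)) x) = x" for x
    using B(1)[of t] by (metis blinfun_apply_blinfun_compose id_blinfun.rep_eq id_apply)
  then show ?thesis
    by (intro blinfun_eqI) (simp add: blinfun.add_left blinfun.diff_left blinfun.scaleR_left)
qed

lemma costate_scale: "costate (c * l0) (c *\<^sub>R p) t = c *\<^sub>R costate l0 p t"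
  by (induction t) (auto intro!: blinfun_eqI simp: blinfun.add_left blinfun.diff_left blinfun.scaleR_left algebra_simps)

text \<open>The recursion runs backwards because \<open>B\<close> is also a right inverse. Covectors
  found at the ends of different horizons can so be compared through their initial values in one
  fixed space.\<close>

lemma costate_surj: "\<exists>p. costate l0 p t = q"
proof (induction t arbitrary: q)
  case (Suc t)
  obtain p where p: "costate l0 p t = (q o\<^sub>L A1 (Suc t)) + l0 *\<^sub>R P1 (Suc t)"
    using Suc by blast
  have "blinfun_apply (A1 (Suc t)) (blinfun_apply (B (Suc t)) x) = x" for x
    using B(2)[of t] by (metis blinfun_apply_blinfun_compose id_blinfun.rep_eq id_apply)
  then have "costate l0 p (Suc t) = q"
    by (intro blinfun_eqI) (simp add: p)
  then show ?case ..
qed simp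

lemma continuous_on_costate: "continuous_on UNIV (\<lambda>z. costate (fst z) (snd z) t)"
  by (induction t) (auto intro!: continuous_intros bounded_bilinear.continuous_on[OF bounded_bilinear_blinfun_compose])

text \<open>The control differential of the Hamiltonian p_{t+1} f_t + lambda_0 phi_t at the
  reference pair, that is, (WM) without its constraint terms.\<close>

definition hamiltonian :: "real \<Rightarrow> ('a \<Rightarrow>\<^sub>L real) \<Rightarrow> nat \<Rightarrow> ('b \<Rightarrow>\<^sub>L real)" where
  "hamiltonian l0 p t = (costate l0 p t o\<^sub>L A2 t) + l0 *\<^sub>R P2 t"

text \<open>Discrete summation by parts: the adjoint equation makes the state terms telescope and
  leaves the control terms. Nothing remains at time 0, as the linearized state starts at 0.\<close>

lemma sum_hamiltonian:
  "l0 * payoff h v + costate l0 p h (trajectory A 0 v (Suc h)) = (\<Sum>t\<le>h. hamiltonian l0 p t (v t))"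
proof (induction h)
  case 0
  show ?case
    by (simp add: payoff_def hamiltonian_def A_split P_split blinfun.add_left blinfun.scaleR_left)
next
  case (Suc h)
  let ?y = "trajectory A 0 v (Suc h)"
  have "l0 * payoff (Suc h) v + costate l0 p (Suc h) (trajectory A 0 v (Suc (Suc h)))
      = l0 * payoff h v + ((costate l0 p (Suc h) o\<^sub>L A1 (Suc h)) + l0 *\<^sub>R P1 (Suc h)) ?y
        + hamiltonian l0 p (Suc h) (v (Suc h))"
    unfolding trajectory.simps(2)[of A 0 v "Suc h"]
    by (simp add: payoff_def hamiltonian_def A_split P_split blinfun.add_left blinfun.add_right blinfun.scaleR_left
        algebra_simps del: trajectory.simps costate.simps)
  then show ?case
    unfolding costate_adjoint[symmetric] using Suc by simp
qed

text \<open>Controls at different times vary independently, so the inequality for the sum splits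
  into one inequality per time. Rescaling to norm 1 prepares the compactness argument.\<close>

lemma finite_horizon_multiplier:
  obtains z where "norm z = 1" "fst z \<ge> 0"
    "\<And>t v. t \<le> h \<Longrightarrow> v \<in> strict_cone t \<Longrightarrow> hamiltonian (fst z) (snd z) t v \<le> 0"
proof -
  obtain l0 q where q: "(l0, q) \<noteq> (0, 0)" "l0 \<ge> 0"
    "\<And>v. (\<And>t. t \<le> h \<Longrightarrow> v t \<in> strict_cone t) \<Longrightarrow> l0 * payoff h v + q \<bullet> trajectory A 0 v (Suc h) \<le> 0"
    using terminal_multiplier by blast
  obtain p where p: "costate l0 p h = blinfun_inner_left q"
    using costate_surj by blast
  have nz: "(l0, p) \<noteq> 0"
  proof
    assume "(l0, p) = 0"
    then have *: "l0 = 0" "p = 0" by (simp_all add: zero_prod_def)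
    then have "costate l0 p t = 0" for t
      using costate_scale[of 0 l0 p t] by simp
    then have "q \<bullet> q = 0"
      using p by (metis blinfun_inner_left.rep_eq inner_commute zero_blinfun.rep_eq)
    with q(1) * show False by simp
  qed
  obtain vb where vb: "\<And>t. vb t \<in> strict_cone t"
    using strict_cone_selection by blast
  have H: "hamiltonian l0 p t v \<le> 0" if t: "t \<le> h" and v: "v \<in> strict_cone t" for t v
  proof (rule tendsto_upperbound)
    let ?S = "\<Sum>s\<in>{..h} - {t}. hamiltonian l0 p s (vb s)"
    have "((\<lambda>\<epsilon>. hamiltonian l0 p t v + \<epsilon> * ?S) \<longlongrightarrow> hamiltonian l0 p t v + 0 * ?S) (at_right 0)"
      by (intro tendsto_intros)
    then show "((\<lambda>\<epsilon>. hamiltonian l0 p t v + \<epsilon> * ?S) \<longlongrightarrow> hamiltonian l0 p t v) (at_right 0)"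
      by simp
    show "\<forall>\<^sub>F \<epsilon> in at_right 0. hamiltonian l0 p t v + \<epsilon> * ?S \<le> 0"
      using eventually_at_right_less[of 0]
    proof eventually_elim
      case (elim \<epsilon>)
      \<comment> \<open>The control 0 at the other times may violate strictness;
        \<open>\<epsilon> *\<^sub>R vb s\<close> does not, and its contribution vanishes with
        \<open>\<epsilon>\<close>.\<close>
      define u where "u s = (if s = t then v else \<epsilon> *\<^sub>R vb s)" for s
      have "u s \<in> strict_cone s" for s
        using v strict_cone_combination[OF vb vb, of \<epsilon> 0 s] elim by (simp add: u_def)
      then have "(\<Sum>s\<le>h. hamiltonian l0 p s (u s)) \<le> 0"
        using q(3)[of u] unfolding sum_hamiltonian[symmetric] p by (simp add: inner_commute del: trajectory.simps)
      moreover have "(\<Sum>s\<le>h. hamiltonian l0 p s (u s)) = hamiltonian l0 p t v + (\<Sum>s\<in>{..h} - {t}. hamiltonian l0 p s (u s))"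
        using t by (subst sum.remove[of _ t]) (auto simp: u_def)
      moreover have "(\<Sum>s\<in>{..h} - {t}. hamiltonian l0 p s (u s)) = \<epsilon> * ?S"
        unfolding sum_distrib_left by (intro sum.cong) (auto simp: u_def blinfun.scaleR_right)
      ultimately show ?case by simp
    qed
  qed simp
  define c where "c = 1 / norm (l0, p)"
  have c: "c > 0" using nz by (simp add: c_def)
  show ?thesis
  proof (rule that[of "c *\<^sub>R (l0, p)"])
    show "norm (c *\<^sub>R (l0, p)) = 1" unfolding norm_scaleR using nz by (simp add: c_def)
    show "fst (c *\<^sub>R (l0, p)) \<ge> 0" using c q(2) by simp
    fix t v assume "t \<le> h" "v \<in> strict_cone t"
    moreover have "hamiltonian (c * l0) (c *\<^sub>R p) t v = c * hamiltonian l0 p t v"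
      by (simp add: hamiltonian_def costate_scale blinfun.add_left blinfun.scaleR_left algebra_simps)
    ultimately show "hamiltonian (fst (c *\<^sub>R (l0, p))) (snd (c *\<^sub>R (l0, p))) t v \<le> 0"
      using H c by (simp add: mult_nonneg_nonpos)
  qed
qed

text \<open>Invertibility of \<open>A1\<close> makes all costates continuous functions of \<open>(l0, p)\<close>, so compactness of one
  sphere suffices for the passage to the infinite horizon.\<close>

lemma infinite_horizon_multiplier:
  obtains l0 p where "(l0, p) \<noteq> (0, 0)" "l0 \<ge> 0"
    "\<And>t v. v \<in> strict_cone t \<Longrightarrow> hamiltonian l0 p t v \<le> 0"
proof -
  define \<Lambda> where "\<Lambda> h = {z. norm z = 1} \<inter> {z. 0 \<le> fst z} \<inter>
    (\<Inter>t\<in>{..h}. \<Inter>v\<in>strict_cone t. {z. hamiltonian (fst z) (snd z) t v \<le> 0})" for h :: nat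
  have "closed {z. hamiltonian (fst z) (snd z) t v \<le> 0}" for t v
  proof (rule closed_Collect_le[OF _ continuous_on_const])
    have "continuous_on UNIV (\<lambda>z. hamiltonian (fst z) (snd z) t)"
      unfolding hamiltonian_def
      by (intro continuous_intros bounded_bilinear.continuous_on[OF bounded_bilinear_blinfun_compose] continuous_on_costate)
    then show "continuous_on UNIV (\<lambda>z. blinfun_apply (hamiltonian (fst z) (snd z) t) v)"
      by (intro continuous_intros)
  qed
  moreover have "closed {z :: real \<times> ('a \<Rightarrow>\<^sub>L real). 0 \<le> fst z}"
    by (intro closed_Collect_le continuous_intros)
  moreover have "compact {z :: real \<times> ('a \<Rightarrow>\<^sub>L real). norm z = 1}"
    unfolding compact_eq_bounded_closed
    by (auto intro!: boundedI[of _ 1] closed_Collect_eq continuous_intros)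
  ultimately have "compact (\<Lambda> h)" for h
    unfolding \<Lambda>_def Int_assoc by (intro compact_Int_closed closed_Int closed_INT ballI)
  moreover have "\<Lambda> h \<noteq> {}" for h
  proof -
    obtain z where "norm z = 1" "fst z \<ge> 0"
      "\<And>t v. t \<le> h \<Longrightarrow> v \<in> strict_cone t \<Longrightarrow> hamiltonian (fst z) (snd z) t v \<le> 0"
      using finite_horizon_multiplier by blast
    then have "z \<in> \<Lambda> h" by (auto simp: \<Lambda>_def)
    then show ?thesis by blast
  qed
  moreover have "\<Lambda> n \<subseteq> \<Lambda> m" if "m \<le> n" for m n
    unfolding \<Lambda>_def using that by fastforce
  ultimately have "\<Inter> (range \<Lambda>) \<noteq> {}"
    by (rule compact_nest)
  then obtain z where z: "\<And>h. z \<in> \<Lambda> h" by blast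
  show ?thesis
  proof (rule that[of "fst z" "snd z"])
    have "z \<noteq> 0" "fst z \<ge> 0" using z[of 0] by (auto simp: \<Lambda>_def)
    then show "(fst z, snd z) \<noteq> (0, 0)" "fst z \<ge> 0" by (auto simp: zero_prod_def)
    show "hamiltonian (fst z) (snd z) t v \<le> 0" if "v \<in> strict_cone t" for t v
      using z[of t] that by (auto simp: \<Lambda>_def)
  qed
qed

text \<open>Farkas' lemma needs the sign of \<open>\<psi>\<close> on the closed cone. Adding a small
  multiple of a strict direction enters the strict cone, and letting it shrink transfers the
  sign.\<close>

lemma control_multipliers:
  assumes "\<And>v. v \<in> strict_cone t \<Longrightarrow> blinfun_apply \<psi> v \<le> 0"
  obtains l m where "\<And>k. k \<in> active t \<Longrightarrow> m k \<ge> (0::real)"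
    "\<psi> + (\<Sum>j\<in>{1..me}. l j *\<^sub>R E t j) + (\<Sum>k\<in>active t. m k *\<^sub>R G t k) = 0"
proof (rule covector_farkas[of "{1..me}" "active t" "E t" "G t" \<psi>])
  obtain vb where vb: "vb \<in> strict_cone t"
    using strict_cone_nonempty by blast
  fix v assume v: "\<And>j. j \<in> {1..me} \<Longrightarrow> E t j v = 0" "\<And>k. k \<in> active t \<Longrightarrow> G t k v \<ge> 0"
  have "\<forall>\<^sub>F \<epsilon> in at_right 0. blinfun_apply \<psi> (v + \<epsilon> *\<^sub>R vb) \<le> 0"
    using eventually_at_right_less[of 0]
  proof eventually_elim
    case (elim \<epsilon>)
    then have "v + \<epsilon> *\<^sub>R vb \<in> strict_cone t"
      using v vb by (auto simp: strict_cone_def blinfun.add_right blinfun.scaleR_right intro: add_nonneg_pos)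
    then show ?case by (rule assms)
  qed
  moreover have "((\<lambda>\<epsilon>. blinfun_apply \<psi> (v + \<epsilon> *\<^sub>R vb)) \<longlongrightarrow> blinfun_apply \<psi> (v + 0 *\<^sub>R vb)) (at_right 0)"
    by (intro tendsto_intros)
  ultimately show "blinfun_apply \<psi> v \<le> 0"
    using tendsto_upperbound[where F = "at_right (0::real)"] by fastforce
qed (auto simp: active_def intro: that)

end

section \<open>Solutions of the infinite-horizon problems\<close>

lemma partial_frechet_D:
  fixes \<Phi> :: "'a::real_normed_vector \<times> 'b::real_normed_vector \<Rightarrow> 'c::real_normed_vector"
  assumes "\<Phi> differentiable (at (a, b))"
  shows "(\<lambda>x. \<Phi> (x, b)) differentiable (at a)" "(\<lambda>u. \<Phi> (a, u)) differentiable (at b)"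
    and "blinfun_apply (frechet_D \<Phi> (a, b)) (x, u) =
      blinfun_apply (frechet_D1 \<Phi> a b) x + blinfun_apply (frechet_D2 \<Phi> a b) u"
proof -
  let ?L = "blinfun_apply (frechet_D \<Phi> (a, b))"
  note D = has_derivative_frechet_D[OF assms]
  have "((\<lambda>x. (x, b)) has_derivative (\<lambda>x. (x, 0))) (at a)" "((\<lambda>u. (a, u)) has_derivative (\<lambda>u. (0, u))) (at b)"
    by (auto intro!: derivative_eq_intros)
  then have 1: "((\<lambda>x. \<Phi> (x, b)) has_derivative (\<lambda>x. ?L (x, 0))) (at a)"
    and 2: "((\<lambda>u. \<Phi> (a, u)) has_derivative (\<lambda>u. ?L (0, u))) (at b)"
    using D by (auto intro: has_derivative_compose)
  then show d: "(\<lambda>x. \<Phi> (x, b)) differentiable (at a)" "(\<lambda>u. \<Phi> (a, u)) differentiable (at b)"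
    by (auto simp: differentiable_def)
  have "blinfun_apply (frechet_D1 \<Phi> a b) = (\<lambda>x. ?L (x, 0))" "blinfun_apply (frechet_D2 \<Phi> a b) = (\<lambda>u. ?L (0, u))"
    using has_derivative_unique[OF 1 has_derivative_frechet_D[OF d(1)]]
      has_derivative_unique[OF 2 has_derivative_frechet_D[OF d(2)]] by simp_all
  moreover have "?L (x, u) = ?L (x, 0) + ?L (0, u)"
    by (simp flip: blinfun.add_right)
  ultimately show "?L (x, u) = blinfun_apply (frechet_D1 \<Phi> a b) x + blinfun_apply (frechet_D2 \<Phi> a b) u"
    by simp
qed

text \<open>The difference of partial sums is constant from \<open>h\<close> on, so its limsup and
  liminf are that constant. For the first problem the common tail makes the competitor's series
  converge, which places it in the domain of \<open>J\<close>.\<close>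

lemma solution_optimal_fixed_endpoint:
  assumes sol: "solution_P1 X U f \<sigma> \<phi> (xh, uh) \<or> solution_P2 X U f \<sigma> \<phi> (xh, uh)
      \<or> solution_P3 X U f \<sigma> \<phi> (xh, uh)"
    and adm: "(x, u) \<in> admissible X U f \<sigma>"
    and late: "\<And>t. t > h \<Longrightarrow> x t = xh t \<and> u t = uh t"
  shows "(\<Sum>t\<le>h. \<phi> t (x t, u t)) \<le> (\<Sum>t\<le>h. \<phi> t (xh t, uh t))"
proof -
  let ?a = "\<lambda>t. \<phi> t (x t, u t)" and ?b = "\<lambda>t. \<phi> t (xh t, uh t)"
  have eq: "?a (t + Suc h) = ?b (t + Suc h)" for t
    using late[of "t + Suc h"] by simp
  have upto: "J_upto \<phi> (xh, uh) n - J_upto \<phi> (x, u) n = (\<Sum>t\<le>h. ?b t) - (\<Sum>t\<le>h. ?a t)" if "n \<ge> h" for n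
  proof -
    have "(\<Sum>t=0..n. ?b t - ?a t) = (\<Sum>t\<le>h. ?b t - ?a t)"
      using that late by (intro sum.mono_neutral_right) auto
    then show ?thesis by (simp add: J_upto_def sum_subtractf)
  qed
  then have ev: "\<forall>\<^sub>F n in sequentially. ereal (J_upto \<phi> (xh, uh) n - J_upto \<phi> (x, u) n) = ereal ((\<Sum>t\<le>h. ?b t) - (\<Sum>t\<le>h. ?a t))"
    by (auto intro: eventually_sequentiallyI)
  from sol consider "solution_P1 X U f \<sigma> \<phi> (xh, uh)" | "solution_P2 X U f \<sigma> \<phi> (xh, uh)" | "solution_P3 X U f \<sigma> \<phi> (xh, uh)"
    by blast
  then show ?thesis
  proof cases
    case 1
    then have sb: "summable ?b"
      by (simp add: solution_P1_def dom_e_def)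
    then have "summable (\<lambda>t. ?b (t + Suc h))"
      by (rule summable_ignore_initial_segment)
    then have "summable (\<lambda>t. ?a (t + Suc h))"
      unfolding eq .
    then have sa: "summable ?a"
      using summable_iff_shift[of ?a "Suc h"] by blast
    with 1 adm have "suminf ?a \<le> suminf ?b"
      by (auto simp: solution_P1_def dom_e_def J_def)
    then show ?thesis
      unfolding suminf_split_initial_segment[OF sa, of "Suc h"] suminf_split_initial_segment[OF sb, of "Suc h"] eq
      by (simp add: lessThan_Suc_atMost)
  next
    case 2
    then have "limsup (\<lambda>n. ereal (J_upto \<phi> (xh, uh) n - J_upto \<phi> (x, u) n)) \<ge> 0"
      using adm by (simp add: solution_P2_def)
    then show ?thesis
      unfolding Limsup_eq[OF ev] by (simp add: Limsup_const)
  next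
    case 3
    then have "liminf (\<lambda>n. ereal (J_upto \<phi> (xh, uh) n - J_upto \<phi> (x, u) n)) \<ge> 0"
      using adm by (simp add: solution_P3_def)
    then show ?thesis
      unfolding Liminf_eq[OF ev] by (simp add: Liminf_const)
  qed
qed

theorem theorem4p8:
  fixes X :: "nat \<Rightarrow> (real ^ 'n) set"
    and U :: "nat \<Rightarrow> (real ^ 'd) set"
    and f :: "nat \<Rightarrow> (real ^ 'n) \<times> (real ^ 'd) \<Rightarrow> real ^ 'n"
    and \<phi> :: "nat \<Rightarrow> (real ^ 'n) \<times> (real ^ 'd) \<Rightarrow> real"
    and \<sigma> :: "real ^ 'n"
    and mi me :: nat
    and g e :: "nat \<Rightarrow> nat \<Rightarrow> real ^ 'd \<Rightarrow> real"
    and xh :: "nat \<Rightarrow> real ^ 'n"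
    and uh :: "nat \<Rightarrow> real ^ 'd"
  assumes X: "\<And>t. open (X t)" "\<And>t. X t \<noteq> {}"
    and U_nonempty: "\<And>t. U t \<noteq> {}"
    and f: "\<And>t. f t \<in> X t \<times> U t \<rightarrow> X (Suc t)"
    and \<sigma>: "\<sigma> \<in> X 0"
    and U: "\<And>t. U t = (\<Inter>k\<in>{1..mi}. {u. g t k u \<ge> 0}) \<inter> (\<Inter>j\<in>{1..me}. {u. e t j u = 0})"
    and sol: "solution_P1 X U f \<sigma> \<phi> (xh, uh) \<or> solution_P2 X U f \<sigma> \<phi> (xh, uh)
      \<or> solution_P3 X U f \<sigma> \<phi> (xh, uh)"
    and i: "\<And>t. \<phi> t differentiable (at (xh t, uh t))"
    and ii: "\<And>t. continuous_near (f t) (xh t, uh t)"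
      "\<And>t. f t differentiable (at (xh t, uh t))"
    and iii: "\<And>t k. k \<in> {1..mi} \<Longrightarrow> g t k (uh t) = 0 \<Longrightarrow> g t k differentiable (at (uh t))"
    and iv: "\<And>t k. k \<in> {1..mi} \<Longrightarrow> g t k (uh t) > 0 \<Longrightarrow>
        lsc_at (g t k) (uh t) \<and> gateaux_differentiable (g t k) (uh t)"
    and v: "\<And>t j. j \<in> {1..me} \<Longrightarrow> continuous_near (e t j) (uh t)"
      "\<And>t j. j \<in> {1..me} \<Longrightarrow> e t j differentiable (at (uh t))"
    and vi: "\<And>t. span ((\<lambda>j. frechet_D (e t j) (uh t)) ` {1..me}) \<inter>
        convex hull ((\<lambda>k. gateaux_D (g t k) (uh t)) ` {k \<in> {1..mi}. g t k (uh t) = 0}) = {}"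
    and vii: "\<And>t. inj_on (\<lambda>j. frechet_D (e t j) (uh t)) {1..me}"
      "\<And>t. independent ((\<lambda>j. frechet_D (e t j) (uh t)) ` {1..me})"
    and viii: "\<And>t. t \<ge> 1 \<Longrightarrow> invertible_blinfun (gateaux_D1 (f t) (xh t) (uh t))"
  shows "\<exists>(lam0 :: real) (p :: nat \<Rightarrow> (real ^ 'n) \<Rightarrow>\<^sub>L real)
      (lam :: nat \<Rightarrow> nat \<Rightarrow> real) (mu :: nat \<Rightarrow> nat \<Rightarrow> real).
    (lam0, p 1) \<noteq> (0, 0) \<and>
    lam0 \<ge> 0 \<and> (\<forall>t. \<forall>k\<in>{1..mi}. mu t k \<ge> 0) \<and>
    (\<forall>t. \<forall>k\<in>{1..mi}. mu t k * g t k (uh t) = 0) \<and>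
    (\<forall>t\<ge>1. p t = (p (t + 1) o\<^sub>L gateaux_D1 (f t) (xh t) (uh t))
        + lam0 *\<^sub>R frechet_D1 (\<phi> t) (xh t) (uh t)) \<and>
    (\<forall>t. (p (t + 1) o\<^sub>L gateaux_D2 (f t) (xh t) (uh t))
        + lam0 *\<^sub>R frechet_D2 (\<phi> t) (xh t) (uh t)
        + (\<Sum>j=1..me. lam t j *\<^sub>R frechet_D (e t j) (uh t))
        + (\<Sum>k=1..mi. mu t k *\<^sub>R gateaux_D (g t k) (uh t)) = 0)"
proof -
  define A where "A t = frechet_D (f t) (xh t, uh t)" for t
  define P where "P t = frechet_D (\<phi> t) (xh t, uh t)" for t
  define E where "E = (\<lambda>t j. frechet_D (e t j) (uh t))"
  define G where "G t k = gateaux_D (g t k) (uh t)" for t k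
  define A1 where "A1 t = gateaux_D1 (f t) (xh t) (uh t)" for t
  define A2 where "A2 t = gateaux_D2 (f t) (xh t) (uh t)" for t
  define P1 where "P1 t = frechet_D1 (\<phi> t) (xh t) (uh t)" for t
  define P2 where "P2 t = frechet_D2 (\<phi> t) (xh t) (uh t)" for t
  have adm: "(xh, uh) \<in> admissible X U f \<sigma>"
    using sol by (auto simp: solution_P1_def solution_P2_def solution_P3_def dom_e_def)
  then have adm': "xh t \<in> X t" "uh t \<in> U t" "xh (Suc t) = f t (xh t, uh t)" "xh 0 = \<sigma>" for t
    by (auto simp: admissible_def)
  have G_active: "G t k = frechet_D (g t k) (uh t)" if "k \<in> {1..mi}" "g t k (uh t) = 0" for t k
    unfolding G_def using iii[OF that] by (rule frechet_imp_gateaux(2))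
  interpret extremal_process X U f \<phi> g e mi me xh uh "\<lambda>t. blinfun_apply (A t)" "\<lambda>t. blinfun_apply (P t)" E G
  proof
    show "u \<in> U t \<longleftrightarrow> (\<forall>k\<in>{1..mi}. g t k u \<ge> 0) \<and> (\<forall>j\<in>{1..me}. e t j u = 0)" for t u
      by (auto simp: U)
    show "(\<Sum>t\<le>h. \<phi> t (x t, u t)) \<le> (\<Sum>t\<le>h. \<phi> t (xh t, uh t))"
      if "x 0 = xh 0" "\<And>t. x t \<in> X t" "\<And>t. u t \<in> U t" "\<And>t. x (Suc t) = f t (x t, u t)"
        "\<And>t. t > h \<Longrightarrow> x t = xh t \<and> u t = uh t" for h x u
      using that by (intro solution_optimal_fixed_endpoint[OF sol]) (auto simp: admissible_def adm')
    show "(g t k has_derivative blinfun_apply (G t k)) (at (uh t))" if "k \<in> {1..mi}" "g t k (uh t) = 0" for t k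
      unfolding G_active[OF that] by (rule has_derivative_frechet_D[OF iii[OF that]])
    show "(f t has_derivative blinfun_apply (A t)) (at (xh t, uh t))" "(\<phi> t has_derivative blinfun_apply (P t)) (at (xh t, uh t))" for t
      unfolding A_def P_def by (rule has_derivative_frechet_D ii i)+
    show "(e t j has_derivative blinfun_apply (E t j)) (at (uh t))" if "j \<in> {1..me}" for t j
      unfolding E_def by (rule has_derivative_frechet_D[OF v(2)[OF that]])
    show "lsc_at (g t k) (uh t)" if "k \<in> {1..mi}" "g t k (uh t) > 0" for t k
      using iv[OF that] by blast
  qed (rule f adm' ii(1) v(1), assumption?)+
  have "\<forall>t. \<exists>b. b o\<^sub>L A1 (Suc t) = id_blinfun \<and> A1 (Suc t) o\<^sub>L b = id_blinfun"
    using viii unfolding invertible_blinfun_def A1_def by simp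
  then obtain b where b: "\<forall>t. b t o\<^sub>L A1 (Suc t) = id_blinfun \<and> A1 (Suc t) o\<^sub>L b t = id_blinfun"
    by (rule choice[THEN exE])
  \<comment> \<open>Aligns the chosen inverses with \<open>A1\<close>: \<open>B (Suc t)\<close> is
    \<open>b t\<close>, and \<open>B 0\<close> is a filler.\<close>
  define B where "B t = b (t - 1)" for t
  have "\<forall>t. \<exists>d. \<forall>i\<in>{1..me}. \<forall>j\<in>{1..me}. blinfun_apply (E t i) (d j) = (if i = j then 1 else 0)"
  proof
    fix t
    have "inj_on (E t) {1..me}" "independent (E t ` {1..me})"
      using vii[of t] by (simp_all add: E_def)
    then show "\<exists>d. \<forall>i\<in>{1..me}. \<forall>j\<in>{1..me}. blinfun_apply (E t i) (d j) = (if i = j then 1 else 0)"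
      by (rule covector_dual_family) blast
  qed
  then obtain d where d: "\<forall>t. \<forall>i\<in>{1..me}. \<forall>j\<in>{1..me}. blinfun_apply (E t i) (d t j) = (if i = j then 1 else 0)"
    by (rule choice[THEN exE])
  interpret regular_process X U f \<phi> g e mi me xh uh "\<lambda>t. blinfun_apply (A t)" "\<lambda>t. blinfun_apply (P t)" E G A1 A2 P1 P2 B d
  proof
    show "blinfun_apply (A t) (x, v) = A1 t x + A2 t v" for t x v
      unfolding A_def A1_def A2_def partial_frechet_D(3)[OF ii(2)]
        frechet_imp_gateaux(2)[OF partial_frechet_D(1)[OF ii(2)]] frechet_imp_gateaux(2)[OF partial_frechet_D(2)[OF ii(2)]] ..
    show "blinfun_apply (P t) (x, v) = P1 t x + P2 t v" for t x v
      unfolding P_def P1_def P2_def partial_frechet_D(3)[OF i] ..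
    show "strict_cone t \<noteq> {}" for t
    proof -
      have "span (E t ` {1..me}) \<inter> convex hull (G t ` active t) = {}"
        using vi[of t] by (simp add: E_def G_def active_def)
      then obtain w where "\<And>j. j \<in> {1..me} \<Longrightarrow> E t j w = 0" "\<And>k. k \<in> active t \<Longrightarrow> G t k w > 0"
        using covector_strict_direction[of "active t" "E t" "{1..me}" "G t"] by (auto simp: active_def)
      then have "w \<in> strict_cone t" by (simp add: strict_cone_def)
      then show ?thesis by blast
    qed
  qed (use b d in \<open>simp_all add: B_def\<close>)
  obtain lam0 p1 where lam0: "(lam0, p1) \<noteq> (0, 0)" "lam0 \<ge> 0"
    "\<And>t v. v \<in> strict_cone t \<Longrightarrow> hamiltonian lam0 p1 t v \<le> 0"
    using infinite_horizon_multiplier by blast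
  have "\<exists>lm. (\<forall>k\<in>active t. snd lm k \<ge> 0) \<and> hamiltonian lam0 p1 t
      + (\<Sum>j\<in>{1..me}. fst lm j *\<^sub>R E t j) + (\<Sum>k\<in>active t. snd lm k *\<^sub>R G t k) = 0" for t
  proof (rule control_multipliers[OF lam0(3)])
    fix l m assume "\<And>k. k \<in> active t \<Longrightarrow> m k \<ge> (0::real)"
      "hamiltonian lam0 p1 t + (\<Sum>j\<in>{1..me}. l j *\<^sub>R E t j) + (\<Sum>k\<in>active t. m k *\<^sub>R G t k) = 0"
    then show ?thesis by (intro exI[of _ "(l, m)"]) simp
  qed
  then have "\<forall>t. \<exists>lm. (\<forall>k\<in>active t. snd lm k \<ge> 0) \<and> hamiltonian lam0 p1 t
      + (\<Sum>j\<in>{1..me}. fst lm j *\<^sub>R E t j) + (\<Sum>k\<in>active t. snd lm k *\<^sub>R G t k) = 0" ..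
  from choice[OF this] obtain lm where lm: "\<And>t k. k \<in> active t \<Longrightarrow> snd (lm t) k \<ge> 0"
    "\<And>t. hamiltonian lam0 p1 t + (\<Sum>j\<in>{1..me}. fst (lm t) j *\<^sub>R E t j)
      + (\<Sum>k\<in>active t. snd (lm t) k *\<^sub>R G t k) = 0"
    by blast
  \<comment> \<open>Extension by 0 to inactive indices yields complementary slackness: either the
    multiplier or the constraint value vanishes.\<close>
  define mu where "mu t k = (if k \<in> active t then snd (lm t) k else 0)" for t k
  have mu: "(\<Sum>k\<in>{1..mi}. mu t k *\<^sub>R G t k) = (\<Sum>k\<in>active t. snd (lm t) k *\<^sub>R G t k)" for t
    by (rule sum.mono_neutral_cong_right) (auto simp: mu_def active_def)
  \<comment> \<open>\<open>costate\<close> at 0 is p_1, whence the shift \<open>t - 1\<close>, which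
    is exact for \<open>t \<ge> 1\<close>.\<close>
  show ?thesis
  proof (rule exI[of _ lam0], rule exI[of _ "\<lambda>t. costate lam0 p1 (t - 1)"],
      rule exI[of _ "\<lambda>t. fst (lm t)"], rule exI[of _ mu], intro conjI allI ballI impI)
    show "(lam0, costate lam0 p1 (1 - 1)) \<noteq> (0, 0)" "lam0 \<ge> 0"
      using lam0 by simp_all
    show "mu t k \<ge> 0" for t k
      using lm(1) by (simp add: mu_def)
    show "mu t k * g t k (uh t) = 0" for t k
      by (simp add: mu_def active_def)
    show "costate lam0 p1 (t - 1) = (costate lam0 p1 (t + 1 - 1) o\<^sub>L gateaux_D1 (f t) (xh t) (uh t))
        + lam0 *\<^sub>R frechet_D1 (\<phi> t) (xh t) (uh t)" if "t \<ge> 1" for t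
      using costate_adjoint[of lam0 p1 "t - 1"] that by (simp add: A1_def P1_def)
    show "(costate lam0 p1 (t + 1 - 1) o\<^sub>L gateaux_D2 (f t) (xh t) (uh t))
        + lam0 *\<^sub>R frechet_D2 (\<phi> t) (xh t) (uh t)
        + (\<Sum>j=1..me. fst (lm t) j *\<^sub>R frechet_D (e t j) (uh t))
        + (\<Sum>k=1..mi. mu t k *\<^sub>R gateaux_D (g t k) (uh t)) = 0" for t
      using lm(2)[of t] mu[of t] by (simp add: hamiltonian_def A2_def P2_def E_def G_def)
  qed
qed

end
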